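(* Let $A_1,\dots,A_m,B$ be real symmetric $n\times n$ matrices such that the semidefinite system $$(P_{SD})\qquad \sum_{i=1}^m x_iA_i\preceq B$$ is feasible, and suppose that for some $0\le r\le n$ the matrix $Z=\begin{pmatrix} I_r & 0 \\ 0 & 0 \end{pmatrix}$ is a maximum rank slack of $(P_{SD})$. Then $(P_{SD})$ is well behaved if and only if both of the following conditions hold (in all block partitions the upper left block is $r\times r$): (1) There is a symmetric positive definite matrix $U$ such that $A_i\bullet\begin{pmatrix} 0 & 0 \\ 0 & U \end{pmatrix}=0$ for all $i=1,\dots,m$. (2) If $V$ is a linear combination of $A_1,\dots,A_m$ of the form $V=\begin{pmatrix} V_{11} & V_{12} \\ V_{12}^T & 0 \end{pmatrix}$, then $V_{12}=0$.
   Context: For symmetric matrices $S,T$, $S\preceq T$ means $T-S$ is positive semidefinite (psd), and $S\bullet T:=\operatorname{trace}(ST)$. For $c\in\mathbb R^m$ consider the primal-dual pair $$(\text{SDP-P})\quad \sup\Big\{\sum_{i=1}^m c_ix_i : \sum_{i=1}^m x_iA_i\preceq B\Big\},\qquad (\text{SDP-D})\quad \inf\{B\bullet Y: A_i\bullet Y=c_i\ (i=1,\dots,m),\ Y\succeq 0\}.$$ A feasible system $(P_{SD})$ is badly behaved if there is $c\in\mathbb R^m$ for which the optimal value of (SDP-P) is finite but (SDP-D) has no feasible solution $Y$ whose value $B\bullet Y$ equals it. It is well behaved if it is not badly behaved. A slack of $(P_{SD})$ is a psd matrix of the form $B-\sum_{i=1}^m x_iA_i$ with $x\in\mathbb R^m$;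 a maximum rank slack is a slack whose rank is largest among all slacks. *)

theory Defs
  imports "Jordan_Normal_Form.DL_Rank" "HOL-Library.Extended_Real"
begin

definition sym_mat :: "nat \<Rightarrow> real mat \<Rightarrow> bool" where
  "sym_mat n S \<longleftrightarrow> S \<in> carrier_mat n n \<and> transpose_mat S = S"

definition psd_mat :: "nat \<Rightarrow> real mat \<Rightarrow> bool" where
  "psd_mat n S \<longleftrightarrow> sym_mat n S \<and> (\<forall>v \<in> carrier_vec n. 0 \<le> v \<bullet> (S *\<^sub>v v))"

definition pd_mat :: "nat \<Rightarrow> real mat \<Rightarrow> bool" where
  "pd_mat n S \<longleftrightarrow> sym_mat n S \<and> (\<forall>v \<in> carrier_vec n. v \<noteq> 0\<^sub>v n \<longrightarrow> 0 < v \<bullet> (S *\<^sub>v v))"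

definition loewner_le :: "nat \<Rightarrow> real mat \<Rightarrow> real mat \<Rightarrow> bool" where
  "loewner_le n S T \<longleftrightarrow> psd_mat n (T - S)"

definition mat_trace :: "real mat \<Rightarrow> real" where
  "mat_trace S = (\<Sum>i<dim_row S. S $$ (i, i))"

definition trace_prod :: "real mat \<Rightarrow> real mat \<Rightarrow> real" where
  "trace_prod S T = mat_trace (S * T)"

text \<open>
  The family \<open>A\<^sub>1, \<dots>, A\<^sub>m\<close> is \<open>A 0, \<dots>, A (m - 1)\<close>; only these values of \<open>A\<close> are used below.
\<close>

definition mat_lincomb :: "nat \<Rightarrow> nat \<Rightarrow> (nat \<Rightarrow> real mat) \<Rightarrow> real vec \<Rightarrow> real mat" where
  "mat_lincomb n m A x = mat n n (\<lambda>(j, k). \<Sum>i<m. x $ i * A i $$ (j, k))"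

definition sdp_primal_feasible ::
    "nat \<Rightarrow> nat \<Rightarrow> (nat \<Rightarrow> real mat) \<Rightarrow> real mat \<Rightarrow> real vec set" where
  "sdp_primal_feasible n m A B = {x \<in> carrier_vec m. loewner_le n (mat_lincomb n m A x) B}"

definition sdp_primal_value ::
    "nat \<Rightarrow> nat \<Rightarrow> (nat \<Rightarrow> real mat) \<Rightarrow> real mat \<Rightarrow> real vec \<Rightarrow> ereal" where
  "sdp_primal_value n m A B c = (SUP x \<in> sdp_primal_feasible n m A B. ereal (c \<bullet> x))"

definition sdp_dual_feasible ::
    "nat \<Rightarrow> nat \<Rightarrow> (nat \<Rightarrow> real mat) \<Rightarrow> real vec \<Rightarrow> real mat set" where
  "sdp_dual_feasible n m A c = {Y. psd_mat n Y \<and> (\<forall>i<m. trace_prod (A i) Y = c $ i)}"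

text \<open>Bad and good behaviour are meant for feasible systems only.\<close>

definition badly_behaved :: "nat \<Rightarrow> nat \<Rightarrow> (nat \<Rightarrow> real mat) \<Rightarrow> real mat \<Rightarrow> bool" where
  "badly_behaved n m A B \<longleftrightarrow>
     (\<exists>c \<in> carrier_vec m.
        \<bar>sdp_primal_value n m A B c\<bar> \<noteq> \<infinity> \<and>
        \<not> (\<exists>Y \<in> sdp_dual_feasible n m A c.
              ereal (trace_prod B Y) = sdp_primal_value n m A B c))"

definition well_behaved :: "nat \<Rightarrow> nat \<Rightarrow> (nat \<Rightarrow> real mat) \<Rightarrow> real mat \<Rightarrow> bool" where
  "well_behaved n m A B \<longleftrightarrow> \<not> badly_behaved n m A B"

definition sdp_slack :: "nat \<Rightarrow> nat \<Rightarrow> (nat \<Rightarrow> real mat) \<Rightarrow> real mat \<Rightarrow> real mat \<Rightarrow> bool" where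
  "sdp_slack n m A B S \<longleftrightarrow>
     psd_mat n S \<and> (\<exists>x \<in> carrier_vec m. S = B - mat_lincomb n m A x)"

definition max_rank_slack :: "nat \<Rightarrow> nat \<Rightarrow> (nat \<Rightarrow> real mat) \<Rightarrow> real mat \<Rightarrow> real mat \<Rightarrow> bool" where
  "max_rank_slack n m A B Z \<longleftrightarrow>
     sdp_slack n m A B Z \<and>
     (\<forall>S. sdp_slack n m A B S \<longrightarrow> vec_space.rank n S \<le> vec_space.rank n Z)"

end

theory Submission
  imports Defs "HOL-Analysis.Function_Topology"
begin

text \<open>
  Since \<open>Z\<close> has maximum rank, every slack is concentrated in the upper left block. Hence the
  objective \<open>c\<^sub>i = A\<^sub>i \<bullet> N\<close> is constant on the feasible set for every symmetric \<open>N\<close> whose upper left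
  block is zero, and a dual solution \<open>Y\<close> with the same value satisfies \<open>Z \<bullet> Y = 0\<close>, so that only its
  lower right block \<open>Y\<^sub>2\<^sub>2\<close> survives. With \<open>N = diag(0, - I)\<close> the matrix \<open>U = Y\<^sub>2\<^sub>2 + I\<close> witnesses
  condition (1); with \<open>N\<close> the off-diagonal part of \<open>V\<close> one gets \<open>2 |V\<^sub>1\<^sub>2|\<^sup>2 = V \<bullet> N = V \<bullet> Y = 0\<close>,
  which is condition (2).

  Conversely, consider the cone of matrices whose upper left block is positive semidefinite and whose
  lower right block is zero, with no restriction on the off-diagonal blocks. By (2), the functional
  with values \<open>c\<^sub>i\<close> at \<open>A\<^sub>i\<close> and the optimal value at \<open>Z\<close> is nonnegative on this cone within the span
  of \<open>Z\<close> and the \<open>A\<^sub>i\<close>. As \<open>Z\<close> is an order unit for the cone, the functional extends by the argument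
  of M. Riesz to all matrices, one dimension at a time, and the extension is represented by some
  \<open>diag(Y\<^sub>1\<^sub>1, Y\<^sub>2\<^sub>2)\<close> with \<open>Y\<^sub>1\<^sub>1\<close> positive semidefinite. Adding a large multiple of \<open>diag(0, U)\<close>
  makes it a dual solution by (1).
\<close>

subsection \<open>Extension of positive functionals\<close>

text \<open>After rescaling, the only new constraints on the value \<open>s\<close> at coordinate
  \<open>q\<close> come from cone elements with \<open>q\<close>-coordinate \<open>1\<close>, which
  bound \<open>s\<close> from below, and \<open>- 1\<close>, which bound it from above. The sum of
  one of each kind lives on \<open>S\<close>, so \<open>pos\<close> makes every lower bound at most
  every upper bound.\<close>

lemma positive_functional_extension_step:
  fixes C :: "('i \<Rightarrow> real) set" and e \<phi> :: "'i \<Rightarrow> real"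
  assumes S: "finite S" "q \<notin> S"
    and add: "\<And>a b. a \<in> C \<Longrightarrow> b \<in> C \<Longrightarrow> (\<lambda>p. a p + b p) \<in> C"
    and scale: "\<And>a s. a \<in> C \<Longrightarrow> 0 < s \<Longrightarrow> (\<lambda>p. s * a p) \<in> C"
    and unit: "\<And>a. a \<in> C \<Longrightarrow> \<exists>l. (\<lambda>p. l * e p - a p) \<in> C"
    and e: "\<And>p. p \<notin> S \<Longrightarrow> e p = 0"
    and pos: "\<And>a. a \<in> C \<Longrightarrow> (\<And>p. p \<notin> S \<Longrightarrow> a p = 0) \<Longrightarrow> 0 \<le> (\<Sum>p\<in>S. a p * \<phi> p)"
  obtains s where "\<And>a. a \<in> C \<Longrightarrow> (\<And>p. p \<notin> insert q S \<Longrightarrow> a p = 0) \<Longrightarrow>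
    0 \<le> (\<Sum>p\<in>S. a p * \<phi> p) + a q * s"
proof -
  let ?f = "\<lambda>a. \<Sum>p\<in>S. a p * \<phi> p"
  define D where "D = {a \<in> C. \<forall>p. p \<notin> insert q S \<longrightarrow> a p = 0}"
  have fadd: "?f (\<lambda>p. a p + b p) = ?f a + ?f b" for a b
    by (simp add: algebra_simps sum.distrib)
  have fscale: "?f (\<lambda>p. s * a p) = s * ?f a" for a s
    by (simp add: sum_distrib_left mult.assoc)
  have key: "0 \<le> ?f a + ?f b" if "a \<in> D" "b \<in> D" "a q = 1" "b q = - 1" for a b
  proof -
    have "0 \<le> ?f (\<lambda>p. a p + b p)"
    proof (rule pos)
      show "(\<lambda>p. a p + b p) \<in> C" using that by (auto simp: D_def intro: add)
      show "a p + b p = 0" if "p \<notin> S" for p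
        using that \<open>a \<in> D\<close> \<open>b \<in> D\<close> \<open>a q = 1\<close> \<open>b q = - 1\<close> by (cases "p = q") (auto simp: D_def)
    qed
    then show ?thesis by (simp add: fadd)
  qed
  have "\<exists>s. (\<forall>a\<in>D. a q = 1 \<longrightarrow> - ?f a \<le> s) \<and> (\<forall>b\<in>D. b q = - 1 \<longrightarrow> s \<le> ?f b)"
  proof (cases "\<exists>b\<in>D. b q = - 1")
    case True
    then obtain b where b: "b \<in> D" "b q = - 1" by blast
    \<comment> \<open>The largest admissible value of \<open>s\<close>.\<close>
    let ?I = "Inf (?f ` {b \<in> D. b q = - 1})"
    have ne: "?f ` {b \<in> D. b q = - 1} \<noteq> {}" using b by blast
    obtain l where l: "(\<lambda>p. l * e p - b p) \<in> C" using unit b by (auto simp: D_def)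
    \<comment> \<open>The unit vanishes at \<open>q\<close>, so \<open>l * e - b\<close> flips the
      coordinate \<open>- 1\<close> to \<open>1\<close>. This supplies a lower bound, without which
      the infimum would be meaningless.\<close>
    define a where "a = (\<lambda>p. l * e p - b p)"
    have a: "a \<in> D" "a q = 1" using l b e S by (auto simp: D_def a_def)
    have bdd: "bdd_below (?f ` {b \<in> D. b q = - 1})"
      by (rule bdd_belowI[of _ "- ?f a"]) (use key[OF a(1) _ a(2)] in force)
    have "- ?f a \<le> ?I" if "a \<in> D" "a q = 1" for a
      by (rule cInf_greatest[OF ne]) (use key[OF that(1) _ that(2)] in force)
    moreover have "?I \<le> ?f b" if "b \<in> D" "b q = - 1" for b
      by (rule cInf_lower[OF _ bdd]) (use that in auto)
    ultimately show ?thesis by blast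
  next
    case False
    \<comment> \<open>The same flip shows that without upper bounds there are no lower bounds
      either, so any \<open>s\<close> works.\<close>
    have "\<not> (\<exists>a\<in>D. a q = 1)"
    proof
      assume "\<exists>a\<in>D. a q = 1"
      then obtain a where a: "a \<in> D" "a q = 1" by blast
      obtain l where "(\<lambda>p. l * e p - a p) \<in> C" using unit a by (auto simp: D_def)
      then have "(\<lambda>p. l * e p - a p) \<in> D" using a e S by (auto simp: D_def)
      then show False using False a e[OF S(2)] by force
    qed
    then show ?thesis using False by blast
  qed
  then obtain s where s1: "\<And>a. a \<in> D \<Longrightarrow> a q = 1 \<Longrightarrow> - ?f a \<le> s"
    and s2: "\<And>b. b \<in> D \<Longrightarrow> b q = - 1 \<Longrightarrow> s \<le> ?f b" by blast
  show thesis
  proof (rule that[of s])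
    fix a assume a: "a \<in> C" "\<And>p. p \<notin> insert q S \<Longrightarrow> a p = 0"
    consider "a q = 0" | "a q > 0" | "a q < 0" by linarith
    then show "0 \<le> ?f a + a q * s"
    proof cases
      case 1
      have "a p = 0" if "p \<notin> S" for p using a(2) 1 that by (cases "p = q") auto
      then show ?thesis using pos[OF a(1)] 1 by simp
    next
      case 2
      let ?t = "1 / a q"
      have "(\<lambda>p. ?t * a p) \<in> D" using scale[OF a(1), of ?t] a(2) 2 by (auto simp: D_def)
      from s1[OF this] have "- (?t * ?f a) \<le> s" using 2 unfolding fscale by simp
      then show ?thesis using 2 by (simp add: field_simps)
    next
      case 3
      let ?t = "1 / (- a q)"
      have "(\<lambda>p. ?t * a p) \<in> D" using scale[OF a(1), of ?t] a(2) 3 by (auto simp: D_def)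
      from s2[OF this] have "s \<le> ?t * ?f a" using 3 unfolding fscale by simp
      then show ?thesis using 3 by (simp add: field_simps)
    qed
  qed
qed

text \<open>Induction over the finitely many new coordinates. A functional is stored as its values
  on the coordinates, so each step only updates \<open>\<psi>\<close> at one point and the earlier
  values persist.\<close>

lemma positive_functional_extension:
  fixes C :: "('i \<Rightarrow> real) set" and e \<phi> :: "'i \<Rightarrow> real"
  assumes "finite T" and S: "finite S" "S \<inter> T = {}"
    and add: "\<And>a b. a \<in> C \<Longrightarrow> b \<in> C \<Longrightarrow> (\<lambda>p. a p + b p) \<in> C"
    and scale: "\<And>a s. a \<in> C \<Longrightarrow> 0 < s \<Longrightarrow> (\<lambda>p. s * a p) \<in> C"
    and unit: "\<And>a. a \<in> C \<Longrightarrow> \<exists>l. (\<lambda>p. l * e p - a p) \<in> C"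
    and e: "\<And>p. p \<notin> S \<Longrightarrow> e p = 0"
    and pos: "\<And>a. a \<in> C \<Longrightarrow> (\<And>p. p \<notin> S \<Longrightarrow> a p = 0) \<Longrightarrow> 0 \<le> (\<Sum>p\<in>S. a p * \<phi> p)"
  obtains \<psi> where "\<And>p. p \<in> S \<Longrightarrow> \<psi> p = \<phi> p"
    and "\<And>a. a \<in> C \<Longrightarrow> (\<And>p. p \<notin> S \<union> T \<Longrightarrow> a p = 0) \<Longrightarrow> 0 \<le> (\<Sum>p\<in>S \<union> T. a p * \<psi> p)"
proof -
  have "\<exists>\<psi>. (\<forall>p\<in>S. \<psi> p = \<phi> p) \<and>
    (\<forall>a\<in>C. (\<forall>p. p \<notin> S \<union> T \<longrightarrow> a p = 0) \<longrightarrow> 0 \<le> (\<Sum>p\<in>S \<union> T. a p * \<psi> p))"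
    using \<open>finite T\<close> S(2)
  proof (induction T rule: finite_induct)
    case empty
    then show ?case using pos by auto
  next
    case (insert q T)
    then obtain \<psi> where \<psi>: "\<forall>p\<in>S. \<psi> p = \<phi> p"
      "\<forall>a\<in>C. (\<forall>p. p \<notin> S \<union> T \<longrightarrow> a p = 0) \<longrightarrow> 0 \<le> (\<Sum>p\<in>S \<union> T. a p * \<psi> p)"
      by auto
    have q: "q \<notin> S \<union> T" and fin: "finite (S \<union> T)" using insert S by auto
    obtain s where s: "\<And>a. a \<in> C \<Longrightarrow> (\<And>p. p \<notin> insert q (S \<union> T) \<Longrightarrow> a p = 0) \<Longrightarrow>
        0 \<le> (\<Sum>p\<in>S \<union> T. a p * \<psi> p) + a q * s"
      by (rule positive_functional_extension_step[where e = e and C = C and \<phi> = \<psi>, OF fin q add scale unit])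
        (use e \<psi> in auto)
    have "(\<Sum>p\<in>S \<union> insert q T. a p * (\<psi>(q := s)) p) = (\<Sum>p\<in>S \<union> T. a p * \<psi> p) + a q * s" for a
    proof -
      have "(\<Sum>p\<in>S \<union> T. a p * (\<psi>(q := s)) p) = (\<Sum>p\<in>S \<union> T. a p * \<psi> p)"
        using q by (intro sum.cong) auto
      then show ?thesis using q fin by simp
    qed
    then show ?case using s \<psi>(1) q by (intro exI[of _ "\<psi>(q := s)"]) auto
  qed
  then show thesis using that by blast
qed

subsection \<open>Quadratic forms\<close>

text \<open>Parametrised by an index set and an entry function, so that a principal block is
  obtained by shrinking \<open>J\<close>. The entries need not be symmetric.\<close>

definition qform :: "nat set \<Rightarrow> (nat \<Rightarrow> nat \<Rightarrow> real) \<Rightarrow> (nat \<Rightarrow> real) \<Rightarrow> real" where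
  "qform J f v = (\<Sum>i\<in>J. \<Sum>j\<in>J. f i j * v i * v j)"

lemma qform_add: "qform J (\<lambda>i j. f i j + g i j) v = qform J f v + qform J g v"
  by (simp add: qform_def algebra_simps sum.distrib)

lemma qform_diff: "qform J (\<lambda>i j. f i j - g i j) v = qform J f v - qform J g v"
  by (simp add: qform_def algebra_simps sum_subtractf)

lemma qform_scale: "qform J (\<lambda>i j. s * f i j) v = s * qform J f v"
  by (simp add: qform_def sum_distrib_left mult.assoc)

lemma qform_cong:
  assumes "\<And>i j. i \<in> J \<Longrightarrow> j \<in> J \<Longrightarrow> f i j = g i j" "\<And>i. i \<in> J \<Longrightarrow> v i = w i"
  shows "qform J f v = qform J g w"
  using assms by (simp add: qform_def)

lemma qform_scale_vec: "qform J f (\<lambda>i. s * v i) = s\<^sup>2 * qform J f v"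
  by (simp add: qform_def sum_distrib_left power2_eq_square algebra_simps)

lemma qform_diag: "finite J \<Longrightarrow> qform J (\<lambda>i j. if i = j then d i else 0) v = (\<Sum>i\<in>J. d i * (v i)\<^sup>2)"
  by (simp add: qform_def power2_eq_square mult.assoc if_distrib[of "\<lambda>x. x * _"] cong: if_cong)

text \<open>The hypothesis concerns whole terms, which covers both vanishing entries and vanishing
  coordinates of the vector.\<close>

lemma qform_restrict:
  assumes "finite J" "K \<subseteq> J" "\<And>i j. i \<in> J \<Longrightarrow> j \<in> J \<Longrightarrow> i \<notin> K \<or> j \<notin> K \<Longrightarrow> f i j * v i * v j = 0"
  shows "qform J f v = qform K f v"
proof -
  have "qform J f v = (\<Sum>(i, j)\<in>J \<times> J. f i j * v i * v j)"
    by (simp add: qform_def sum.cartesian_product)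
  also have "\<dots> = (\<Sum>(i, j)\<in>K \<times> K. f i j * v i * v j)"
  proof (rule sum.mono_neutral_right)
    show "\<forall>p\<in>J \<times> J - K \<times> K. (case p of (i, j) \<Rightarrow> f i j * v i * v j) = 0"
    proof
      fix p assume "p \<in> J \<times> J - K \<times> K"
      then obtain i j where "p = (i, j)" "i \<in> J" "j \<in> J" "i \<notin> K \<or> j \<notin> K" by auto
      then show "(case p of (i, j) \<Rightarrow> f i j * v i * v j) = 0" using assms(3)[of i j] by simp
    qed
  qed (use assms in auto)
  also have "\<dots> = qform K f v"
    by (simp add: qform_def sum.cartesian_product)
  finally show ?thesis .
qed

lemma abs_qform_le:
  assumes "finite J"
  shows "\<bar>qform J f v\<bar> \<le> (\<Sum>i\<in>J. \<Sum>j\<in>J. \<bar>f i j\<bar>) * (\<Sum>i\<in>J. (v i)\<^sup>2)"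
proof -
  have *: "\<bar>v i * v j\<bar> \<le> (\<Sum>i\<in>J. (v i)\<^sup>2)" if "i \<in> J" "j \<in> J" for i j
  proof -
    have "(v k)\<^sup>2 \<le> (\<Sum>i\<in>J. (v i)\<^sup>2)" if "k \<in> J" for k
      using assms that by (intro member_le_sum) auto
    from this[OF that(1)] this[OF that(2)] have "(v i)\<^sup>2 + (v j)\<^sup>2 \<le> 2 * (\<Sum>i\<in>J. (v i)\<^sup>2)" by simp
    moreover have "2 * \<bar>v i * v j\<bar> \<le> (v i)\<^sup>2 + (v j)\<^sup>2"
      using sum_squares_bound[of "\<bar>v i\<bar>" "\<bar>v j\<bar>"] by (simp add: abs_mult mult.assoc)
    ultimately show ?thesis by linarith
  qed
  have "\<bar>qform J f v\<bar> \<le> (\<Sum>i\<in>J. \<Sum>j\<in>J. \<bar>f i j * v i * v j\<bar>)"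
    unfolding qform_def by (intro order_trans[OF sum_abs] sum_mono) auto
  also have "\<dots> \<le> (\<Sum>i\<in>J. \<Sum>j\<in>J. \<bar>f i j\<bar> * (\<Sum>i\<in>J. (v i)\<^sup>2))"
    using * by (intro sum_mono) (auto simp: abs_mult mult.assoc intro!: mult_left_mono)
  finally show ?thesis by (simp add: sum_distrib_right)
qed

text \<open>The constant \<open>d\<close> is the minimum of the form over the unit sphere, attained
  by compactness; homogeneity of degree two carries the bound to all vectors.\<close>

lemma positive_definite_qform_coercive:
  assumes J: "finite J"
    and pd: "\<And>v. \<exists>i\<in>J. v i \<noteq> 0 \<Longrightarrow> 0 < qform J f v"
  obtains d where "0 < d" and "\<And>v. d * (\<Sum>i\<in>J. (v i)\<^sup>2) \<le> qform J f v"
proof (cases "J = {}")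
  case True
  then show ?thesis by (intro that[of 1]) (auto simp: qform_def)
next
  case False
  \<comment> \<open>Vectors are functions on all of \<open>nat\<close>. Pinning the coordinates
    outside \<open>J\<close> to \<open>0\<close> makes \<open>K\<close> a product of compact sets,
    hence compact by Tychonoff, and the sphere \<open>S\<close> a closed part of it.\<close>
  define K where "K = (\<Pi>\<^sub>E i\<in>UNIV. if i \<in> J then {-1..1::real} else {0})"
  define S where "S = K \<inter> {v. (\<Sum>i\<in>J. (v i)\<^sup>2) = 1}"
  have cont: "continuous_on UNIV (\<lambda>v :: nat \<Rightarrow> real. v i)" for i by simp
  have "compactin (product_topology (\<lambda>i::nat. euclidean :: real topology) UNIV) K"
    unfolding K_def compactin_PiE by auto
  then have "compact K" by (simp add: euclidean_product_topology)
  moreover have "closed {v :: nat \<Rightarrow> real. (\<Sum>i\<in>J. (v i)\<^sup>2) = 1}"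
    by (intro closed_Collect_eq continuous_intros cont)
  ultimately have comp: "compact S" unfolding S_def by (rule compact_Int_closed)
  obtain k where k: "k \<in> J" using False by blast
  have "(\<lambda>i. if i = k then 1 else 0) \<in> S"
    using k J by (auto simp: S_def K_def if_distrib[of "\<lambda>x. x ^ 2"] cong: if_cong)
  then have ne: "S \<noteq> {}" by blast
  have contS: "continuous_on S (\<lambda>v. v i)" for i
    using cont continuous_on_subset by blast
  have "continuous_on S (qform J f)"
    unfolding qform_def by (intro continuous_intros contS)
  from continuous_attains_inf[OF comp ne this] obtain w where
    w: "w \<in> S" "\<And>v. v \<in> S \<Longrightarrow> qform J f w \<le> qform J f v" by blast
  have "\<exists>i\<in>J. w i \<noteq> 0"
  proof (rule ccontr)
    assume "\<not> ?thesis"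
    then have "(\<Sum>i\<in>J. (w i)\<^sup>2) = 0" by simp
    then show False using w(1) by (simp add: S_def)
  qed
  then have pos: "0 < qform J f w" by (rule pd)
  show ?thesis
  proof (rule that[OF pos])
    fix v :: "nat \<Rightarrow> real"
    define N where "N = (\<Sum>i\<in>J. (v i)\<^sup>2)"
    show "qform J f w * (\<Sum>i\<in>J. (v i)\<^sup>2) \<le> qform J f v"
    proof (cases "N = 0")
      case True
      then have "v i = 0" if "i \<in> J" for i
        using that J by (simp add: N_def sum_nonneg_eq_0_iff)
      then have "qform J f v = 0" by (simp add: qform_def)
      then show ?thesis using True by (simp add: N_def)
    next
      case False
      then have N: "N > 0" using sum_nonneg[of J "\<lambda>i. (v i)\<^sup>2"] by (simp add: N_def)
      \<comment> \<open>The normalised vector, cut off outside \<open>J\<close> as membership in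
        \<open>K\<close> requires; the form only sees coordinates in \<open>J\<close>.\<close>
      define u where "u = (\<lambda>i. if i \<in> J then 1 / sqrt N * v i else 0)"
      have sum1: "(\<Sum>i\<in>J. (u i)\<^sup>2) = 1"
        using N by (simp add: u_def power_divide sum_divide_distrib[symmetric] N_def)
      have "\<bar>u i\<bar> \<le> 1" if "i \<in> J" for i
      proof -
        have "(u i)\<^sup>2 \<le> (\<Sum>i\<in>J. (u i)\<^sup>2)" using that J by (intro member_le_sum) auto
        then show ?thesis using sum1 by (simp add: abs_square_le_1)
      qed
      then have "- 1 \<le> u i \<and> u i \<le> 1" if "i \<in> J" for i using that by (simp add: abs_le_iff)
      moreover have "u i = 0" if "i \<notin> J" for i using that by (simp add: u_def)
      ultimately have "u \<in> S" using sum1 by (auto simp: S_def K_def)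
      then have "qform J f w \<le> qform J f u" by (rule w(2))
      also have "qform J f u = qform J f (\<lambda>i. 1 / sqrt N * v i)"
        by (rule qform_cong) (simp_all add: u_def)
      also have "\<dots> = qform J f v / N"
        unfolding qform_scale_vec using N by (simp add: power_divide)
      finally show ?thesis using N by (simp add: field_simps N_def)
    qed
  qed
qed

text \<open>The form of \<open>g\<close> is at least \<open>- c\<close> times the squared norm, with
  \<open>c\<close> the sum of the absolute entries, and coercivity with constant \<open>d\<close>
  compensates this for \<open>t = c / d\<close>.\<close>

lemma qform_add_large_multiple_nonneg:
  assumes J: "finite J"
    and pd: "\<And>v. \<exists>i\<in>J. v i \<noteq> 0 \<Longrightarrow> 0 < qform J f v"
  obtains t where "\<And>v. 0 \<le> qform J g v + t * qform J f v"
proof -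
  obtain d where d: "0 < d" "\<And>v. d * (\<Sum>i\<in>J. (v i)\<^sup>2) \<le> qform J f v"
    using positive_definite_qform_coercive[OF assms] by blast
  let ?c = "\<Sum>i\<in>J. \<Sum>j\<in>J. \<bar>g i j\<bar>"
  have c: "0 \<le> ?c / d" using d(1) by (intro divide_nonneg_pos sum_nonneg) auto
  have "0 \<le> qform J g v + ?c / d * qform J f v" for v
  proof -
    have "?c * (\<Sum>i\<in>J. (v i)\<^sup>2) \<le> ?c / d * qform J f v"
      using mult_left_mono[OF d(2)[of v] c] d(1) by simp
    then show ?thesis using abs_qform_le[OF J, of g v] by linarith
  qed
  then show thesis by (rule that)
qed

subsection \<open>Symmetric matrices, traces and rank\<close>

lemma scalar_prod_mult_mat_vec_qform:
  assumes "S \<in> carrier_mat n n" "v \<in> carrier_vec n"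
  shows "v \<bullet> (S *\<^sub>v v) = qform {..<n} (\<lambda>i j. S $$ (i, j)) (\<lambda>i. v $ i)"
  using assms
  by (auto simp: scalar_prod_def qform_def sum_distrib_left atLeast0LessThan algebra_simps intro!: sum.cong)

lemma psd_mat_iff_qform:
  "psd_mat n S \<longleftrightarrow> sym_mat n S \<and> (\<forall>v. 0 \<le> qform {..<n} (\<lambda>i j. S $$ (i, j)) v)"
proof -
  have "0 \<le> qform {..<n} (\<lambda>i j. S $$ (i, j)) v" if "psd_mat n S" for v
  proof -
    have "0 \<le> vec n v \<bullet> (S *\<^sub>v vec n v)" using that by (simp add: psd_mat_def)
    also have "\<dots> = qform {..<n} (\<lambda>i j. S $$ (i, j)) (\<lambda>i. vec n v $ i)"
      using that by (intro scalar_prod_mult_mat_vec_qform) (auto simp: psd_mat_def sym_mat_def)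
    also have "\<dots> = qform {..<n} (\<lambda>i j. S $$ (i, j)) v" by (rule qform_cong) auto
    finally show ?thesis .
  qed
  then show ?thesis
    by (auto simp: psd_mat_def sym_mat_def scalar_prod_mult_mat_vec_qform)
qed

lemma pd_mat_iff_qform:
  "pd_mat n S \<longleftrightarrow> sym_mat n S \<and> (\<forall>v. (\<exists>i<n. v i \<noteq> 0) \<longrightarrow> 0 < qform {..<n} (\<lambda>i j. S $$ (i, j)) v)"
proof -
  have "0 < qform {..<n} (\<lambda>i j. S $$ (i, j)) v" if "pd_mat n S" "i < n" "v i \<noteq> 0" for v i
  proof -
    have "vec n v \<noteq> 0\<^sub>v n"
    proof
      assume "vec n v = 0\<^sub>v n"
      then have "vec n v $ i = 0" using that(2) by simp
      then show False using that by simp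
    qed
    then have "0 < vec n v \<bullet> (S *\<^sub>v vec n v)" using that by (simp add: pd_mat_def)
    also have "\<dots> = qform {..<n} (\<lambda>i j. S $$ (i, j)) (\<lambda>i. vec n v $ i)"
      using that by (intro scalar_prod_mult_mat_vec_qform) (auto simp: pd_mat_def sym_mat_def)
    also have "\<dots> = qform {..<n} (\<lambda>i j. S $$ (i, j)) v" by (rule qform_cong) auto
    finally show ?thesis .
  qed
  moreover have "\<exists>i<n. v $ i \<noteq> 0" if "v \<in> carrier_vec n" "v \<noteq> 0\<^sub>v n" for v :: "real vec"
    using that by (metis eq_vecI carrier_vecD index_zero_vec)
  ultimately show ?thesis
    by (auto simp: pd_mat_def sym_mat_def scalar_prod_mult_mat_vec_qform)
qed

section \<open>Symmetry and the trace inner product\<close>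

lemma sym_mat_iff:
  "sym_mat n S \<longleftrightarrow> S \<in> carrier_mat n n \<and> (\<forall>i<n. \<forall>j<n. S $$ (i, j) = S $$ (j, i))"
proof -
  have "S $$ (i, j) = S $$ (j, i)" if "S \<in> carrier_mat n n" "transpose_mat S = S" "i < n" "j < n" for i j
    using that by (metis carrier_matD index_transpose_mat(1))
  then show ?thesis by (auto simp: sym_mat_def intro!: eq_matI)
qed

text \<open>The trace of the product pairs entry \<open>(i, j)\<close> of \<open>S\<close> with
  entry \<open>(j, i)\<close> of \<open>T\<close>; symmetry of \<open>T\<close> turns this into the
  Frobenius inner product.\<close>

lemma trace_prod_sym_mat:
  assumes "S \<in> carrier_mat n n" "sym_mat n T"
  shows "trace_prod S T = (\<Sum>i<n. \<Sum>j<n. S $$ (i, j) * T $$ (i, j))"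
  using assms
  by (auto simp: trace_prod_def mat_trace_def sym_mat_iff scalar_prod_def atLeast0LessThan intro!: sum.cong)

lemma mat_lincomb_carrier [simp]: "mat_lincomb n m A x \<in> carrier_mat n n"
  by (simp add: mat_lincomb_def)

lemma mat_lincomb_dim [simp]:
  "dim_row (mat_lincomb n m A x) = n" "dim_col (mat_lincomb n m A x) = n"
  by (simp_all add: mat_lincomb_def)

lemma mat_lincomb_index:
  "i < n \<Longrightarrow> j < n \<Longrightarrow> mat_lincomb n m A x $$ (i, j) = (\<Sum>l<m. x $ l * A l $$ (i, j))"
  by (simp add: mat_lincomb_def)

lemma sym_mat_lincomb: "(\<And>l. l < m \<Longrightarrow> sym_mat n (A l)) \<Longrightarrow> sym_mat n (mat_lincomb n m A x)"
  by (auto simp: sym_mat_iff mat_lincomb_index intro!: sum.cong)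

lemma trace_prod_lincomb:
  assumes "\<And>l. l < m \<Longrightarrow> sym_mat n (A l)" "sym_mat n Y"
  shows "trace_prod (mat_lincomb n m A x) Y = (\<Sum>l<m. x $ l * trace_prod (A l) Y)"
proof -
  have "trace_prod (mat_lincomb n m A x) Y = (\<Sum>i<n. \<Sum>j<n. \<Sum>l<m. x $ l * (A l $$ (i, j) * Y $$ (i, j)))"
    by (simp add: trace_prod_sym_mat[OF _ assms(2)] mat_lincomb_index sum_distrib_right mult.assoc)
  also have "\<dots> = (\<Sum>i<n. \<Sum>l<m. \<Sum>j<n. x $ l * (A l $$ (i, j) * Y $$ (i, j)))"
    by (intro sum.cong refl sum.swap)
  also have "\<dots> = (\<Sum>l<m. \<Sum>i<n. \<Sum>j<n. x $ l * (A l $$ (i, j) * Y $$ (i, j)))"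
    by (rule sum.swap)
  also have "\<dots> = (\<Sum>l<m. x $ l * trace_prod (A l) Y)"
  proof (rule sum.cong[OF refl])
    fix l assume "l \<in> {..<m}"
    then have "A l \<in> carrier_mat n n" using assms(1) by (auto simp: sym_mat_def)
    then show "(\<Sum>i<n. \<Sum>j<n. x $ l * (A l $$ (i, j) * Y $$ (i, j))) = x $ l * trace_prod (A l) Y"
      by (simp add: trace_prod_sym_mat[OF _ assms(2)] sum_distrib_left)
  qed
  finally show ?thesis .
qed

lemma trace_prod_diff:
  assumes "S \<in> carrier_mat n n" "T \<in> carrier_mat n n" "sym_mat n Y"
  shows "trace_prod (S - T) Y = trace_prod S Y - trace_prod T Y"
proof -
  have "S - T \<in> carrier_mat n n" using assms(2) by (rule minus_carrier_mat)
  from trace_prod_sym_mat[OF this assms(3)] show ?thesis using assms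
    by (simp add: trace_prod_sym_mat[OF _ assms(3)] algebra_simps sum_subtractf)
qed

section \<open>Zero diagonal entries and rank\<close>

lemma psd_mat_diag_nonneg:
  assumes "psd_mat n S" "k < n"
  shows "0 \<le> S $$ (k, k)"
proof -
  have "0 \<le> qform {..<n} (\<lambda>i j. S $$ (i, j)) (\<lambda>i. if i = k then 1 else 0)"
    using assms by (simp add: psd_mat_iff_qform)
  also have "\<dots> = S $$ (k, k)"
    using assms(2) by (simp add: qform_def if_distrib[of "\<lambda>x. _ * x"] cong: if_cong)
  finally show ?thesis .
qed

text \<open>On the vector with entries \<open>s\<close> at \<open>k\<close> and \<open>1\<close> at
  \<open>l\<close> the form is affine in \<open>s\<close>, because the quadratic coefficient is the
  zero diagonal entry. It stays nonnegative for all \<open>s\<close> only if its slope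
  vanishes.\<close>

lemma psd_mat_zero_diag_row:
  assumes S: "psd_mat n S" and k: "k < n" "S $$ (k, k) = 0" and l: "l < n"
  shows "S $$ (k, l) = 0" "S $$ (l, k) = 0"
proof -
  have sym: "S $$ (l, k) = S $$ (k, l)" using assms by (simp add: psd_mat_iff_qform sym_mat_iff)
  show "S $$ (k, l) = 0"
  proof (cases "k = l")
    case True
    then show ?thesis using k by simp
  next
    case False
    have nonneg: "0 \<le> 2 * s * S $$ (k, l) + S $$ (l, l)" for s
    proof -
      let ?v = "\<lambda>i. if i = k then s else if i = l then 1 else 0"
      have "0 \<le> qform {..<n} (\<lambda>i j. S $$ (i, j)) ?v"
        using S by (simp add: psd_mat_iff_qform)
      also have "\<dots> = qform {k, l} (\<lambda>i j. S $$ (i, j)) ?v"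
        using k l by (intro qform_restrict) auto
      also have "\<dots> = 2 * s * S $$ (k, l) + S $$ (l, l)"
        using False k sym by (simp add: qform_def)
      finally show ?thesis .
    qed
    show ?thesis
    proof (rule ccontr)
      assume ne: "S $$ (k, l) \<noteq> 0"
      \<comment> \<open>For this \<open>s\<close> the affine function takes the value
        \<open>- 1\<close>.\<close>
      from nonneg[of "- (S $$ (l, l) + 1) / (2 * S $$ (k, l))"] ne show False
        by (simp add: field_simps)
    qed
  qed
  then show "S $$ (l, k) = 0" using sym by simp
qed

text \<open>A kernel vector of \<open>T\<close> has zero quadratic form, so no nonzero vector
  supported in \<open>J\<close> lies in the kernel. Hence the columns indexed by \<open>J\<close>
  are independent.\<close>

lemma card_le_rank_if_qform_nonzero:
  fixes T :: "real mat"
  assumes T: "T \<in> carrier_mat n n" and J: "J \<subseteq> {..<n}"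
    and nz: "\<And>v k. (\<And>i. i \<notin> J \<Longrightarrow> v i = 0) \<Longrightarrow> k \<in> J \<Longrightarrow> v k \<noteq> 0 \<Longrightarrow>
      qform {..<n} (\<lambda>i j. T $$ (i, j)) v \<noteq> 0"
  shows "card J \<le> vec_space.rank n T"
proof -
  interpret vec_space "TYPE(real)" n .
  have kernel: "v k = 0" if v: "\<And>i. i \<notin> J \<Longrightarrow> v i = 0" and "k \<in> J"
    and 0: "\<And>i. i < n \<Longrightarrow> (\<Sum>j<n. T $$ (i, j) * v j) = 0" for v k
  proof (rule ccontr)
    assume "v k \<noteq> 0"
    have "qform {..<n} (\<lambda>i j. T $$ (i, j)) v = (\<Sum>i<n. v i * (\<Sum>j<n. T $$ (i, j) * v j))"
      by (simp add: qform_def sum_distrib_left algebra_simps)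
    also have "\<dots> = 0" using 0 by simp
    finally show False using nz[of v k] v \<open>k \<in> J\<close> \<open>v k \<noteq> 0\<close> by blast
  qed
  \<comment> \<open>Independence is a property of sets of columns, so repeated columns must be
    excluded separately: they would put a difference of two unit vectors into the kernel.\<close>
  have inj: "inj_on (col T) J"
  proof (rule inj_onI, rule ccontr)
    fix i j assume ij: "i \<in> J" "j \<in> J" "col T i = col T j" "i \<noteq> j"
    let ?v = "\<lambda>k. (if k = i then 1 else 0) - (if k = j then 1 else (0::real))"
    have "T $$ (k, i) = T $$ (k, j)" if "k < n" for k
      using ij J T that by (metis carrier_matD index_col lessThan_iff subsetD)
    then have "(\<Sum>l<n. T $$ (k, l) * ?v l) = 0" if "k < n" for k
      using that ij J by (simp add: right_diff_distrib sum_subtractf if_distrib[of "\<lambda>x. _ * x"] subset_iff cong: if_cong)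
    moreover have "?v k = 0" if "k \<notin> J" for k using that ij by auto
    ultimately have "?v i = 0" using ij(1) kernel[of ?v i] by blast
    then show False using ij(4) by simp
  qed
  have cols: "col T ` J \<subseteq> set (cols T)"
    using J T by (auto simp: cols_def)
  have "lin_indpt (col T ` J)"
  proof
    assume "lin_dep (col T ` J)"
    then obtain W a w where W: "W \<subseteq> col T ` J" "lincomb a W = 0\<^sub>v n" "w \<in> W" "a w \<noteq> 0"
      unfolding lin_dep_def by auto
    define I where "I = {i \<in> J. col T i \<in> W}"
    have I: "col T ` I = W" "inj_on (col T) I" "I \<subseteq> {..<n}"
      using W inj J by (auto simp: I_def inj_on_def)
    \<comment> \<open>A linear relation among the columns, read as a kernel vector supported in
      \<open>J\<close>.\<close>
    define v where "v = (\<lambda>i. if i \<in> I then a (col T i) else 0)"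
    have Wc: "W \<subseteq> carrier_vec n" using W(1) cols cols_dim[of T] T by auto
    have "(\<Sum>j<n. T $$ (i, j) * v j) = 0" if "i < n" for i
    proof -
      have "(\<Sum>j<n. T $$ (i, j) * v j) = (\<Sum>j\<in>I. a (col T j) * col T j $ i)"
        using I(3) T that by (intro sum.mono_neutral_cong_right) (auto simp: v_def)
      also have "\<dots> = (\<Sum>u\<in>W. a u * u $ i)"
        using sum.reindex[OF I(2), of "\<lambda>u. a u * u $ i"] I(1) by simp
      also have "\<dots> = lincomb a W $ i" by (rule lincomb_index[OF that Wc, symmetric])
      finally show ?thesis using W(2) that by simp
    qed
    moreover have "v k = 0" if "k \<notin> J" for k using that by (simp add: v_def I_def)
    ultimately have "v k = 0" if "k \<in> J" for k using kernel[of v k] that by blast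
    moreover obtain k where "k \<in> I" "w = col T k" using W(3) I(1) by blast
    ultimately show False using W(4) by (force simp: v_def I_def)
  qed
  from rank_ge_card_indpt[OF T cols this] show ?thesis
    using card_image[OF inj] by simp
qed

text \<open>The rank is the size of a maximal independent set of columns. Such a set avoids the zero
  vector, hence consists of columns indexed by \<open>J\<close>.\<close>

lemma rank_le_card_if_zero_cols:
  fixes T :: "real mat"
  assumes T: "T \<in> carrier_mat n n" and J: "finite J"
    and z: "\<And>j. j < n \<Longrightarrow> j \<notin> J \<Longrightarrow> col T j = 0\<^sub>v n"
  shows "vec_space.rank n T \<le> card J"
proof -
  interpret vec_space "TYPE(real)" n .
  have cT: "set (cols T) \<subseteq> carrier_vec n" using T cols_dim by blast
  have "\<exists>U. finite U \<and> maximal U (\<lambda>U. U \<subseteq> set (cols T) \<and> lin_indpt U) \<and> {} \<subseteq> U"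
    by (rule maximal_exists_superset[of "set (cols T)"]) (auto simp: lin_dep_def)
  then obtain U where max: "maximal U (\<lambda>U. U \<subseteq> set (cols T) \<and> lin_indpt U)" by blast
  then have U: "U \<subseteq> set (cols T)" "lin_indpt U" by (auto simp: maximal_def)
  have "(UNIV :: real set) \<noteq> {0}" by (auto simp: set_eq_iff intro: exI[of _ 1])
  then have "0\<^sub>v n \<notin> U" using U cT zero_nin_lin_indpt[of U] by auto
  have "U \<subseteq> col T ` J"
  proof
    fix u assume u: "u \<in> U"
    then obtain j where j: "j < n" "u = col T j"
      using U(1) T by (auto simp: cols_def)
    then have "j \<in> J" using z[of j] u \<open>0\<^sub>v n \<notin> U\<close> by (cases "j \<in> J") auto
    then show "u \<in> col T ` J" using j by blast
  qed
  then have "card U \<le> card J"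
    by (meson J card_image_le card_mono finite_imageI order_trans)
  then show ?thesis using rank_card_indpt[OF T max] by simp
qed

subsection \<open>The dual functional\<close>

lemma qform_block_diag:
  assumes "r \<le> n"
    and "\<And>i j. i < r \<Longrightarrow> r \<le> j \<Longrightarrow> j < n \<Longrightarrow> f i j = 0"
    and "\<And>i j. i < r \<Longrightarrow> r \<le> j \<Longrightarrow> j < n \<Longrightarrow> f j i = 0"
  shows "qform {..<n} f v = qform {..<r} f v + qform {r..<n} f v"
proof -
  have un: "{..<n} = {..<r} \<union> {r..<n}" using assms(1) by auto
  have split: "(\<Sum>i<n. h i) = (\<Sum>i<r. h i) + (\<Sum>i\<in>{r..<n}. h i)" for h :: "nat \<Rightarrow> real"
    unfolding un by (rule sum.union_disjoint) auto
  show ?thesis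
    unfolding qform_def split using assms(2,3) by (simp add: sum.distrib)
qed

lemma qform_antisym:
  assumes "\<And>i j. f i j = - f j i"
  shows "qform J f v = 0"
proof -
  have "qform J f v = (\<Sum>i\<in>J. \<Sum>j\<in>J. f j i * v j * v i)"
    unfolding qform_def by (rule sum.swap)
  also have "\<dots> = (\<Sum>i\<in>J. \<Sum>j\<in>J. - (f i j * v i * v j))"
  proof (intro sum.cong refl)
    fix i j
    show "f j i * v j * v i = - (f i j * v i * v j)" using assms[of j i] by (simp add: algebra_simps)
  qed
  also have "\<dots> = - qform J f v" by (simp add: qform_def sum_negf)
  finally show ?thesis by simp
qed

lemma qform_zero: "(\<And>i j. i \<in> J \<Longrightarrow> j \<in> J \<Longrightarrow> f i j = 0) \<Longrightarrow> qform J f v = 0"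
  by (simp add: qform_def)

lemma qform_rank_one: "qform J (\<lambda>i j. u i * u j) v = (\<Sum>i\<in>J. u i * v i)\<^sup>2"
  by (simp add: qform_def power2_eq_square sum_product algebra_simps)

text \<open>The extension theorem applied to the cone from the overview. Here \<open>pos\<close> is
  positivity on the span of \<open>z\<close> and the \<open>A l\<close>, and the values of the
  extended functional on elementary matrices are the entries of \<open>Y\<close>.\<close>

lemma block_dual_functional:
  fixes A :: "nat \<Rightarrow> nat \<Rightarrow> nat \<Rightarrow> real" and c :: "nat \<Rightarrow> real" and r :: nat
  defines "z \<equiv> \<lambda>i j. if i = j \<and> i < r then 1 else 0 :: real"
  assumes rn: "r \<le> n"
    and pos: "\<And>t x. (\<And>v. 0 \<le> qform {..<r} (\<lambda>i j. t * z i j + (\<Sum>l<m. x l * A l i j)) v) \<Longrightarrow>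
      (\<And>v. qform {r..<n} (\<lambda>i j. t * z i j + (\<Sum>l<m. x l * A l i j)) v = 0) \<Longrightarrow>
      0 \<le> t * val + (\<Sum>l<m. x l * c l)"
  obtains Y :: "nat \<Rightarrow> nat \<Rightarrow> real" where
    "\<And>i j. i < n \<Longrightarrow> j < n \<Longrightarrow> Y i j = Y j i"
    and "\<And>i j. i < r \<Longrightarrow> r \<le> j \<Longrightarrow> j < n \<Longrightarrow> Y i j = 0"
    and "\<And>v. 0 \<le> qform {..<r} Y v"
    and "\<And>l. l < m \<Longrightarrow> (\<Sum>i<n. \<Sum>j<n. A l i j * Y i j) = c l"
    and "(\<Sum>i<r. Y i i) = val"
proof -
  \<comment> \<open>Formal coordinates: \<open>Inl 0\<close> for \<open>z\<close>,
    \<open>Inl (Suc l)\<close> for \<open>A l\<close>, \<open>Inr (i, j)\<close> for the elementary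
    matrices; \<open>M a\<close> is the matrix they describe. Linear relations among these matrices
    are harmless: if \<open>M a\<close> is zero, then \<open>a\<close> and its negative both lie in
    \<open>C\<close>.\<close>
  define M where "M = (\<lambda>(a :: nat + nat \<times> nat \<Rightarrow> real) i j.
    a (Inl 0) * z i j + (\<Sum>l<m. a (Inl (Suc l)) * A l i j) + a (Inr (i, j)))"
  \<comment> \<open>Both conditions are on quadratic forms, so antisymmetric matrices lie in the
    cone together with their negatives. This is what makes \<open>Y\<close> symmetric.\<close>
  define C where "C = {a. (\<forall>v. 0 \<le> qform {..<r} (M a) v) \<and> (\<forall>v. qform {r..<n} (M a) v = 0)}"
  define S :: "(nat + nat \<times> nat) set" where "S = Inl ` {..<Suc m}"
  define T :: "(nat + nat \<times> nat) set" where "T = Inr ` ({..<n} \<times> {..<n})"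
  define e :: "nat + nat \<times> nat \<Rightarrow> real" where "e = (\<lambda>p. if p = Inl 0 then 1 else 0)"
  define \<phi> where "\<phi> = case_sum (case_nat val c) (\<lambda>_ :: nat \<times> nat. 0)"
  have M_add: "M (\<lambda>p. a p + b p) = (\<lambda>i j. M a i j + M b i j)" for a b
    by (simp add: M_def fun_eq_iff algebra_simps sum.distrib)
  have M_scale: "M (\<lambda>p. s * a p) = (\<lambda>i j. s * M a i j)" for a s
    by (simp add: M_def fun_eq_iff algebra_simps sum_distrib_left)
  have M_unit: "M (\<lambda>p. l * e p - a p) = (\<lambda>i j. l * z i j - M a i j)" for a l
    by (simp add: M_def fun_eq_iff algebra_simps sum_negf e_def)
  have sumS: "(\<Sum>p\<in>S. a p * \<psi> p) = a (Inl 0) * \<psi> (Inl 0) + (\<Sum>l<m. a (Inl (Suc l)) * \<psi> (Inl (Suc l)))"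
    for a \<psi> :: "nat + nat \<times> nat \<Rightarrow> real"
  proof -
    have "(\<Sum>p\<in>S. a p * \<psi> p) = (\<Sum>k<Suc m. a (Inl k) * \<psi> (Inl k))"
      unfolding S_def by (simp add: sum.reindex)
    then show ?thesis by (simp add: sum.lessThan_Suc_shift del: sum.lessThan_Suc)
  qed
  have sumT: "(\<Sum>p\<in>T. a p * \<psi> p) = (\<Sum>i<n. \<Sum>j<n. a (Inr (i, j)) * \<psi> (Inr (i, j)))"
    for a \<psi> :: "nat + nat \<times> nat \<Rightarrow> real"
    unfolding T_def by (simp add: sum.reindex sum.cartesian_product case_prod_unfold)
  have disj: "S \<inter> T = {}" and fin: "finite S" "finite T" by (auto simp: S_def T_def)
  have qz1: "qform {..<r} z v = (\<Sum>i<r. (v i)\<^sup>2)" for v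
  proof -
    have "qform {..<r} z v = qform {..<r} (\<lambda>i j. if i = j then 1 else 0) v"
      by (rule qform_cong) (auto simp: z_def)
    then show ?thesis by (simp add: qform_diag)
  qed
  have qz2: "qform {r..<n} z v = 0" for v by (rule qform_zero) (auto simp: z_def)
  have unit: "\<exists>l. (\<lambda>p. l * e p - a p) \<in> C" if "a \<in> C" for a
  proof -
    \<comment> \<open>On the upper left block \<open>z\<close> is the identity, so this bound on the
      form of \<open>M a\<close> makes \<open>l * z - M a\<close> positive semidefinite there; on
      the lower block both forms vanish.\<close>
    define l where "l = (\<Sum>i<r. \<Sum>j<r. \<bar>M a i j\<bar>)"
    have "qform {..<r} (M a) v \<le> l * (\<Sum>i<r. (v i)\<^sup>2)" for v
      using abs_qform_le[of "{..<r}" "M a" v] by (simp add: l_def)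
    then have "(\<lambda>p. l * e p - a p) \<in> C"
      using that by (simp add: C_def M_unit qform_diff qform_scale qz1 qz2)
    then show ?thesis by blast
  qed
  have base: "0 \<le> (\<Sum>p\<in>S. a p * \<phi> p)" if "a \<in> C" "\<And>p. p \<notin> S \<Longrightarrow> a p = 0" for a
  proof -
    have "a (Inr q) = 0" for q by (rule that(2)) (auto simp: S_def)
    then have "M a = (\<lambda>i j. a (Inl 0) * z i j + (\<Sum>l<m. a (Inl (Suc l)) * A l i j))"
      by (simp add: M_def fun_eq_iff)
    then show ?thesis
      using that(1) pos[of "a (Inl 0)" "\<lambda>l. a (Inl (Suc l))"] by (simp add: C_def sumS \<phi>_def)
  qed
  obtain \<psi> where \<psi>: "\<And>p. p \<in> S \<Longrightarrow> \<psi> p = \<phi> p"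
    and \<psi>pos: "\<And>a. a \<in> C \<Longrightarrow> (\<And>p. p \<notin> S \<union> T \<Longrightarrow> a p = 0) \<Longrightarrow> 0 \<le> (\<Sum>p\<in>S \<union> T. a p * \<psi> p)"
  proof (rule positive_functional_extension[of T S C e \<phi>, OF fin(2,1) disj])
    show "(\<lambda>p. a p + b p) \<in> C" if "a \<in> C" "b \<in> C" for a b
      using that by (simp add: C_def M_add qform_add)
    show "(\<lambda>p. s * a p) \<in> C" if "a \<in> C" "0 < s" for a s
      using that by (simp add: C_def M_scale qform_scale)
    show "e p = 0" if "p \<notin> S" for p using that by (auto simp: e_def S_def)
  qed (use unit base in blast)+
  define Y where "Y = (\<lambda>i j. \<psi> (Inr (i, j)))"
  \<comment> \<open>Positivity of the extension, stated for matrices. Truncating \<open>x\<close> at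
    \<open>m\<close> and \<open>g\<close> at \<open>n\<close> puts the support of the coordinates
    into \<open>S \<union> T\<close> and leaves the relevant entries unchanged.\<close>
  have main: "0 \<le> t * val + (\<Sum>l<m. x l * c l) + (\<Sum>i<n. \<Sum>j<n. g i j * Y i j)"
    if "\<And>v. 0 \<le> qform {..<r} (\<lambda>i j. t * z i j + (\<Sum>l<m. x l * A l i j) + g i j) v"
      "\<And>v. qform {r..<n} (\<lambda>i j. t * z i j + (\<Sum>l<m. x l * A l i j) + g i j) v = 0" for t x g
  proof -
    define a where "a = case_sum (case_nat t (\<lambda>l. if l < m then x l else 0))
      (\<lambda>(i, j). if i < n \<and> j < n then g i j else 0)"
    have Ma: "M a i j = t * z i j + (\<Sum>l<m. x l * A l i j) + g i j" if "i < n" "j < n" for i j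
      using that by (simp add: M_def a_def)
    have 1: "qform {..<r} (M a) v = qform {..<r} (\<lambda>i j. t * z i j + (\<Sum>l<m. x l * A l i j) + g i j) v" for v
      using rn by (intro qform_cong Ma) auto
    have 2: "qform {r..<n} (M a) v = qform {r..<n} (\<lambda>i j. t * z i j + (\<Sum>l<m. x l * A l i j) + g i j) v" for v
      by (intro qform_cong Ma) auto
    have "a \<in> C" using that by (simp add: C_def 1 2)
    moreover have "a p = 0" if "p \<notin> S \<union> T" for p
      using that by (auto simp: a_def S_def T_def split: sum.split nat.split)
    ultimately have "0 \<le> (\<Sum>p\<in>S. a p * \<psi> p) + (\<Sum>p\<in>T. a p * \<psi> p)"
      using \<psi>pos[of a] fin disj by (simp add: sum.union_disjoint)
    moreover have "(\<Sum>p\<in>S. a p * \<psi> p) = (\<Sum>p\<in>S. a p * \<phi> p)" using \<psi> by simp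
    ultimately show ?thesis by (simp add: sumS sumT \<phi>_def a_def Y_def)
  qed
  \<comment> \<open>If both diagonal blocks have zero form, the element and its negative are in the
    cone, so the functional vanishes.\<close>
  have main0: "t * val + (\<Sum>l<m. x l * c l) + (\<Sum>i<n. \<Sum>j<n. g i j * Y i j) = 0"
    if 1: "\<And>v. qform {..<r} (\<lambda>i j. t * z i j + (\<Sum>l<m. x l * A l i j) + g i j) v = 0"
      and 2: "\<And>v. qform {r..<n} (\<lambda>i j. t * z i j + (\<Sum>l<m. x l * A l i j) + g i j) v = 0" for t x g
  proof -
    have neg: "(\<lambda>i j. (- t) * z i j + (\<Sum>l<m. (- x l) * A l i j) + (- g i j)) =
        (\<lambda>i j. (- 1) * (t * z i j + (\<Sum>l<m. x l * A l i j) + g i j))"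
      by (simp add: fun_eq_iff sum_negf algebra_simps)
    have "0 \<le> (- t) * val + (\<Sum>l<m. (- x l) * c l) + (\<Sum>i<n. \<Sum>j<n. (- g i j) * Y i j)"
      by (rule main) (unfold neg qform_scale 1 2, simp_all)
    moreover have "0 \<le> t * val + (\<Sum>l<m. x l * c l) + (\<Sum>i<n. \<Sum>j<n. g i j * Y i j)"
      by (rule main) (simp_all add: 1 2)
    ultimately show ?thesis by (simp add: sum_negf)
  qed
  have mainE: "0 \<le> (\<Sum>i<n. \<Sum>j<n. g i j * Y i j)"
    if "\<And>v. 0 \<le> qform {..<r} g v" "\<And>v. qform {r..<n} g v = 0" for g
    using main[of 0 "\<lambda>_. 0" g] that by simp
  have main0E: "(\<Sum>i<n. \<Sum>j<n. g i j * Y i j) = 0"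
    if "\<And>v. qform {..<r} g v = 0" "\<And>v. qform {r..<n} g v = 0" for g
    using main0[of 0 "\<lambda>_. 0" g] that by simp
  have delta: "(\<Sum>i<n. \<Sum>j<n. (if i = k \<and> j = l then 1 else 0) * Y i j) = Y k l" if "k < n" "l < n" for k l
  proof -
    have "(\<Sum>i<n. \<Sum>j<n. (if i = k \<and> j = l then 1 else 0) * Y i j) =
        (\<Sum>i<n. \<Sum>j<n. if j = l then (if i = k then Y i j else 0) else 0)"
      by (intro sum.cong) auto
    then show ?thesis using that by simp
  qed
  show thesis
  proof (rule that[of Y])
    show "Y k l = Y l k" if "k < n" "l < n" for k l
    proof -
      let ?g = "\<lambda>i j. (if i = k \<and> j = l then 1 else 0) - (if i = l \<and> j = k then 1 else 0 :: real)"
      have "qform J ?g v = 0" for J v by (rule qform_antisym) (simp add: conj_commute)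
      then have "(\<Sum>i<n. \<Sum>j<n. ?g i j * Y i j) = 0"
        by (intro main0E)
      then have "(\<Sum>i<n. \<Sum>j<n. (if i = k \<and> j = l then 1 else 0) * Y i j) =
          (\<Sum>i<n. \<Sum>j<n. (if i = l \<and> j = k then 1 else 0) * Y i j)"
        unfolding left_diff_distrib sum_subtractf by simp
      then show ?thesis unfolding delta[OF that] delta[OF that(2,1)] .
    qed
    show "Y k l = 0" if "k < r" "r \<le> l" "l < n" for k l
    proof -
      let ?g = "\<lambda>i j. if i = k \<and> j = l then 1 else 0 :: real"
      have "qform {..<r} ?g v = 0" "qform {r..<n} ?g v = 0" for v
        using that by (auto intro!: qform_zero)
      then have "(\<Sum>i<n. \<Sum>j<n. ?g i j * Y i j) = 0"
        by (intro main0E)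
      then show ?thesis using delta[of k l] that rn by simp
    qed
    show "0 \<le> qform {..<r} Y v" for v
    proof -
      \<comment> \<open>The rank one matrix of \<open>v\<close>, padded by zeros, lies in the cone,
        and its value is the quadratic form of \<open>Y\<close> at \<open>v\<close>.\<close>
      let ?g = "\<lambda>i j. (if i < r then v i else 0) * (if j < r then v j else 0)"
      have "0 \<le> qform {..<r} ?g w" for w
        unfolding qform_rank_one by simp
      moreover have "qform {r..<n} ?g w = 0" for w by (rule qform_zero) auto
      ultimately have "0 \<le> (\<Sum>i<n. \<Sum>j<n. ?g i j * Y i j)"
        by (intro mainE)
      also have "\<dots> = qform {..<n} Y (\<lambda>i. if i < r then v i else 0)"
        by (simp add: qform_def mult_ac)
      also have "\<dots> = qform {..<r} Y (\<lambda>i. if i < r then v i else 0)"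
        using rn by (intro qform_restrict) auto
      also have "\<dots> = qform {..<r} Y v" by (rule qform_cong) auto
      finally show ?thesis .
    qed
    show "(\<Sum>i<n. \<Sum>j<n. A l i j * Y i j) = c l" if "l < m" for l
    proof -
      have delta': "(\<Sum>k<m. (if k = l then 1 else 0) * h k) = h l" for h :: "nat \<Rightarrow> real"
        using that by (simp add: if_distrib[of "\<lambda>x. x * _"] cong: if_cong)
      \<comment> \<open>\<open>A l\<close> taken as a generator cancels against \<open>- A l\<close>
        taken as a sum of elementary matrices, so the two ways of evaluating the functional agree.
        The same device with \<open>z\<close> yields the trace of the upper block.\<close>
      have "0 * val + (\<Sum>k<m. (if k = l then 1 else 0) * c k) + (\<Sum>i<n. \<Sum>j<n. (- A l i j) * Y i j) = 0"
        by (rule main0) (simp_all add: delta' qform_zero)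
      then show ?thesis by (simp add: delta' sum_negf)
    qed
    show "(\<Sum>i<r. Y i i) = val"
    proof -
      have "1 * val + (\<Sum>k<m. 0 * c k) + (\<Sum>i<n. \<Sum>j<n. (- z i j) * Y i j) = 0"
        by (rule main0) (simp_all add: qform_zero)
      moreover have "(\<Sum>i<n. \<Sum>j<n. z i j * Y i j) = (\<Sum>i<r. Y i i)"
      proof -
        have "(\<Sum>i<n. \<Sum>j<n. z i j * Y i j) = (\<Sum>i<n. \<Sum>j<n. if j = i then (if i < r then Y i i else 0) else 0)"
          by (intro sum.cong) (auto simp: z_def)
        also have "\<dots> = (\<Sum>i<n. if i < r then Y i i else 0)" by simp
        also have "\<dots> = (\<Sum>i<r. Y i i)"
          using rn by (intro sum.mono_neutral_cong_right) auto
        finally show ?thesis .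
      qed
      ultimately show ?thesis by (simp add: sum_negf)
    qed
  qed
qed

subsection \<open>Slacks and dual solutions\<close>

text \<open>Polarisation: unit vectors give the diagonal entries, sums of two unit vectors the
  others.\<close>

lemma qform_eq_zero_imp:
  assumes J: "finite J" and sym: "\<And>i j. i \<in> J \<Longrightarrow> j \<in> J \<Longrightarrow> f i j = f j i"
    and 0: "\<And>v. qform J f v = 0" and kl: "k \<in> J" "l \<in> J"
  shows "f k l = 0"
proof -
  have diag: "f i i = 0" if "i \<in> J" for i
  proof -
    have "qform J f (\<lambda>j. if j = i then 1 else 0) = qform {i} f (\<lambda>j. if j = i then 1 else 0)"
      using J that by (intro qform_restrict) auto
    then show ?thesis using 0 by (simp add: qform_def)
  qed
  show ?thesis
  proof (cases "k = l")
    case False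
    let ?v = "\<lambda>j. if j = k \<or> j = l then 1 else 0"
    have "qform J f ?v = qform {k, l} f ?v"
      using J kl by (intro qform_restrict) auto
    then show ?thesis using 0 False sym[OF kl] diag[OF kl(1)] diag[OF kl(2)] by (simp add: qform_def)
  qed (use diag kl in simp)
qed

lemma mat_lincomb_vec_index:
  "i < n \<Longrightarrow> j < n \<Longrightarrow> mat_lincomb n m A (vec m f) $$ (i, j) = (\<Sum>l<m. f l * A l $$ (i, j))"
  by (simp add: mat_lincomb_index)

lemma block_identity_index:
  assumes "r \<le> n" "i < n" "j < n"
  shows "four_block_mat (1\<^sub>m r) (0\<^sub>m r (n - r)) (0\<^sub>m (n - r) r) (0\<^sub>m (n - r) (n - r)) $$ (i, j) =
    (if i = j \<and> i < r then 1 else 0 :: real)"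
  using assms by auto

lemma qform_partial_identity:
  assumes "r \<le> n"
  shows "qform {..<n} (\<lambda>i j. if i = j \<and> i < r then 1 else 0) v = (\<Sum>i<r. (v i)\<^sup>2)"
proof -
  have "qform {..<n} (\<lambda>i j. if i = j \<and> i < r then 1 else 0) v =
      qform {..<n} (\<lambda>i j. if i = j then (if i < r then 1 else 0) else 0) v"
    by (rule qform_cong) auto
  also have "\<dots> = (\<Sum>i<n. (if i < r then 1 else 0) * (v i)\<^sup>2)" by (simp add: qform_diag)
  also have "\<dots> = (\<Sum>i<r. (v i)\<^sup>2)"
    using assms by (intro sum.mono_neutral_cong_right) auto
  finally show ?thesis .
qed

text \<open>Averaging a slack with \<open>Z\<close> gives a slack whose kernel is the intersection of both kernels.\<close>

lemma max_rank_slack_zero_block: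
  assumes rn: "r \<le> n" and B: "B \<in> carrier_mat n n"
    and Z: "Z \<in> carrier_mat n n" "\<And>i j. i < n \<Longrightarrow> j < n \<Longrightarrow> Z $$ (i, j) = (if i = j \<and> i < r then 1 else 0)"
    and max: "max_rank_slack n m A B Z"
    and S: "sdp_slack n m A B S" and k: "r \<le> k" "k < n" and l: "l < n"
  shows "S $$ (k, l) = 0" "S $$ (l, k) = 0"
proof -
  have psd: "psd_mat n S" using S by (simp add: sdp_slack_def)
  then have Sc: "S \<in> carrier_mat n n" by (simp add: psd_mat_def sym_mat_def)
  have "S $$ (k, k) = 0"
  proof (rule ccontr)
    assume "S $$ (k, k) \<noteq> 0"
    then have Skk: "S $$ (k, k) > 0" using psd_mat_diag_nonneg[OF psd k(2)] by simp
    define T where "T = mat n n (\<lambda>(i, j). 1 / 2 * (S $$ (i, j) + Z $$ (i, j)))"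
    have qT: "qform {..<n} (\<lambda>i j. T $$ (i, j)) v =
        1 / 2 * (qform {..<n} (\<lambda>i j. S $$ (i, j)) v + (\<Sum>i<r. (v i)\<^sup>2))" for v
    proof -
      have "qform {..<n} (\<lambda>i j. T $$ (i, j)) v =
          qform {..<n} (\<lambda>i j. 1 / 2 * (S $$ (i, j) + (if i = j \<and> i < r then 1 else 0))) v"
        by (rule qform_cong) (auto simp: T_def Z(2))
      then show ?thesis by (simp only: qform_scale qform_add qform_partial_identity[OF rn])
    qed
    have "sym_mat n T" using psd by (auto simp: sym_mat_iff T_def psd_mat_def Z(2))
    moreover have "0 \<le> qform {..<n} (\<lambda>i j. T $$ (i, j)) v" for v
      unfolding qT using psd sum_nonneg[of "{..<r}" "\<lambda>i. (v i)\<^sup>2"] by (simp add: psd_mat_iff_qform)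
    ultimately have psdT: "psd_mat n T" by (simp add: psd_mat_iff_qform)
    obtain x where x: "S = B - mat_lincomb n m A x" using S by (auto simp: sdp_slack_def)
    obtain y where y: "Z = B - mat_lincomb n m A y" using max by (auto simp: sdp_slack_def max_rank_slack_def)
    have "T = B - mat_lincomb n m A (vec m (\<lambda>l. 1 / 2 * (x $ l + y $ l)))"
    proof (rule eq_matI)
      fix i j assume "i < dim_row (B - mat_lincomb n m A (vec m (\<lambda>l. 1 / 2 * (x $ l + y $ l))))"
        "j < dim_col (B - mat_lincomb n m A (vec m (\<lambda>l. 1 / 2 * (x $ l + y $ l))))"
      then have ij: "i < n" "j < n" by (auto simp: mat_lincomb_def)
      have "(\<Sum>l<m. 1 / 2 * (x $ l + y $ l) * A l $$ (i, j)) =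
          1 / 2 * ((\<Sum>l<m. x $ l * A l $$ (i, j)) + (\<Sum>l<m. y $ l * A l $$ (i, j)))"
        unfolding sum.distrib[symmetric] sum_distrib_left by (intro sum.cong) (simp_all add: algebra_simps)
      then show "T $$ (i, j) = (B - mat_lincomb n m A (vec m (\<lambda>l. 1 / 2 * (x $ l + y $ l)))) $$ (i, j)"
        unfolding T_def x y using ij by (simp add: mat_lincomb_index mat_lincomb_vec_index mat_lincomb_def)
    qed (auto simp: T_def mat_lincomb_def)
    then have slT: "sdp_slack n m A B T" using psdT by (auto simp: sdp_slack_def)
    have card: "card (insert k {..<r}) = Suc r" using k by simp
    \<comment> \<open>The form of \<open>T\<close> is positive on nonzero vectors supported on these
      \<open>r + 1\<close> coordinates: \<open>Z\<close> controls the first \<open>r\<close> and the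
      positive entry of \<open>S\<close> controls \<open>k\<close>. So \<open>T\<close> outranks
      \<open>Z\<close>.\<close>
    have "card (insert k {..<r}) \<le> vec_space.rank n T"
    proof (rule card_le_rank_if_qform_nonzero)
      show "T \<in> carrier_mat n n" by (simp add: T_def)
      show "insert k {..<r} \<subseteq> {..<n}" using k rn by auto
      fix v k' assume v: "\<And>i. i \<notin> insert k {..<r} \<Longrightarrow> v i = (0 :: real)"
        and k': "k' \<in> insert k {..<r}" "v k' \<noteq> 0"
      show "qform {..<n} (\<lambda>i j. T $$ (i, j)) v \<noteq> 0"
      proof
        assume "qform {..<n} (\<lambda>i j. T $$ (i, j)) v = 0"
        moreover have "0 \<le> qform {..<n} (\<lambda>i j. S $$ (i, j)) v" "0 \<le> (\<Sum>i<r. (v i)\<^sup>2)"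
          using psd by (auto simp: psd_mat_iff_qform intro: sum_nonneg)
        ultimately have 0: "qform {..<n} (\<lambda>i j. S $$ (i, j)) v = 0" "(\<Sum>i<r. (v i)\<^sup>2) = 0"
          unfolding qT by auto
        have vr: "v i = 0" if "i < r" for i
          using 0(2) that by (simp add: sum_nonneg_eq_0_iff)
        have vk: "v i = 0" if "i \<noteq> k" for i using v[of i] vr[of i] that by auto
        have "qform {..<n} (\<lambda>i j. S $$ (i, j)) v = qform {k} (\<lambda>i j. S $$ (i, j)) v"
          using k vk by (intro qform_restrict) auto
        then have "v k = 0" using 0(1) Skk by (simp add: qform_def)
        then show False using k' vk by (cases "k' = k") auto
      qed
    qed
    moreover have "vec_space.rank n Z \<le> card {..<r}"
      by (rule rank_le_card_if_zero_cols[OF Z(1)]) (use Z in \<open>auto intro!: eq_vecI\<close>)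
    moreover have "vec_space.rank n T \<le> vec_space.rank n Z"
      using max slT by (simp add: max_rank_slack_def)
    ultimately show False using card by simp
  qed
  from psd_mat_zero_diag_row[OF psd k(2) this l] show "S $$ (k, l) = 0" "S $$ (l, k) = 0" .
qed

lemma sdp_feasible_imp_slack:
  "x \<in> sdp_primal_feasible n m A B \<Longrightarrow> sdp_slack n m A B (B - mat_lincomb n m A x)"
  by (auto simp: sdp_primal_feasible_def sdp_slack_def loewner_le_def)

text \<open>The common source of both necessary conditions, which differ only in the choice of
  \<open>N\<close>.\<close>

lemma well_behaved_dual_solution:
  assumes A: "\<And>i. i < m \<Longrightarrow> sym_mat n (A i)" and B: "sym_mat n B"
    and feas: "sdp_primal_feasible n m A B \<noteq> {}" and rn: "r \<le> n"
    and Z: "Z \<in> carrier_mat n n" "\<And>i j. i < n \<Longrightarrow> j < n \<Longrightarrow> Z $$ (i, j) = (if i = j \<and> i < r then 1 else 0)"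
    and max: "max_rank_slack n m A B Z" and well: "well_behaved n m A B"
    and N: "sym_mat n N" "\<And>i j. i < r \<Longrightarrow> j < r \<Longrightarrow> N $$ (i, j) = 0"
  obtains Y where "psd_mat n Y" "\<And>i j. i < n \<Longrightarrow> j < n \<Longrightarrow> i < r \<or> j < r \<Longrightarrow> Y $$ (i, j) = 0"
    "\<And>i. i < m \<Longrightarrow> trace_prod (A i) Y = trace_prod (A i) N"
proof -
  have Bc: "B \<in> carrier_mat n n" using B by (simp add: sym_mat_def)
  define c where "c = vec m (\<lambda>i. trace_prod (A i) N)"
  have cx: "c \<bullet> x = trace_prod (mat_lincomb n m A x) N" if "x \<in> carrier_vec m" for x
    using that by (simp add: trace_prod_lincomb[OF A N(1)] scalar_prod_def c_def atLeast0LessThan mult.commute)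
  have slack0: "trace_prod S N = 0" if S: "sdp_slack n m A B S" for S
  proof -
    have Sc: "S \<in> carrier_mat n n" using S by (auto simp: sdp_slack_def psd_mat_def sym_mat_def)
    have "S $$ (i, j) * N $$ (i, j) = 0" if "i < n" "j < n" for i j
      using max_rank_slack_zero_block[OF rn Bc Z max S] N(2)[of i j] that by (cases "i < r"; cases "j < r") auto
    then show ?thesis unfolding trace_prod_sym_mat[OF Sc N(1)] by (intro sum.neutral ballI) simp
  qed
  have const: "c \<bullet> x = trace_prod B N" if "x \<in> sdp_primal_feasible n m A B" for x
    using slack0[OF sdp_feasible_imp_slack[OF that]] cx[of x] that
    by (simp add: trace_prod_diff[OF Bc _ N(1)] sdp_primal_feasible_def)
  have val: "sdp_primal_value n m A B c = ereal (trace_prod B N)"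
  proof -
    have "sdp_primal_value n m A B c = (SUP x \<in> sdp_primal_feasible n m A B. ereal (trace_prod B N))"
      unfolding sdp_primal_value_def using const by (intro SUP_cong) auto
    then show ?thesis using feas by simp
  qed
  have cc: "c \<in> carrier_vec m" by (simp add: c_def)
  obtain Y where Y: "Y \<in> sdp_dual_feasible n m A c" "trace_prod B Y = trace_prod B N"
    using well cc val by (fastforce simp: well_behaved_def badly_behaved_def)
  then have psd: "psd_mat n Y" and AY: "\<And>i. i < m \<Longrightarrow> trace_prod (A i) Y = trace_prod (A i) N"
    by (auto simp: sdp_dual_feasible_def c_def)
  have symY: "sym_mat n Y" using psd by (simp add: psd_mat_def)
  have slZ: "sdp_slack n m A B Z" using max by (simp add: max_rank_slack_def)
  then obtain x where x: "x \<in> carrier_vec m" "Z = B - mat_lincomb n m A x" by (auto simp: sdp_slack_def)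
  \<comment> \<open>\<open>Y\<close> and \<open>N\<close> have the same products with
    \<open>B\<close> and all \<open>A i\<close>, hence with every slack. Since
    \<open>Z \<bullet> Y\<close> is the sum of the first \<open>r\<close> diagonal entries of the
    psd matrix \<open>Y\<close>, these entries and then their rows and columns vanish.\<close>
  have "trace_prod Z Y = trace_prod Z N"
    unfolding x(2) by (simp add: trace_prod_diff[OF Bc _ symY] trace_prod_diff[OF Bc _ N(1)] Y(2)
        trace_prod_lincomb[OF A symY] trace_prod_lincomb[OF A N(1)] AY)
  also have "\<dots> = 0" by (rule slack0[OF slZ])
  finally have "0 = trace_prod Z Y" by simp
  also have "\<dots> = (\<Sum>i<n. \<Sum>j<n. if j = i then (if i < r then Y $$ (i, i) else 0) else 0)"
    unfolding trace_prod_sym_mat[OF Z(1) symY] by (intro sum.cong) (auto simp: Z(2))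
  also have "\<dots> = (\<Sum>i<n. if i < r then Y $$ (i, i) else 0)" by simp
  finally have "(\<Sum>i<n. if i < r then Y $$ (i, i) else 0) = 0" by simp
  then have diag: "Y $$ (i, i) = 0" if "i < r" for i
    using psd_mat_diag_nonneg[OF psd] that rn by (subst (asm) sum_nonneg_eq_0_iff) (auto split: if_splits)
  have "Y $$ (i, j) = 0" if "i < n" "j < n" "i < r \<or> j < r" for i j
    using that psd_mat_zero_diag_row[OF psd that(1) diag that(2)]
      psd_mat_zero_diag_row[OF psd that(2) diag that(1)] by auto
  then show thesis using that psd AY by blast
qed

text \<open>Homogenisation of the primal problem. For \<open>t < 0\<close> adding \<open>y / \<bar>t\<bar>\<close> to a feasible point gives a
  recession direction.\<close>

lemma homogenized_value_bound:
  fixes q :: "'v \<Rightarrow> real" and Q :: "(nat \<Rightarrow> real) \<Rightarrow> 'v \<Rightarrow> real" and c :: "nat \<Rightarrow> real"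
  defines "P \<equiv> \<lambda>f. \<forall>v. Q f v \<le> q v"
  assumes q: "\<And>v. 0 \<le> q v"
    and Qadd: "\<And>f g v. Q (\<lambda>l. f l + g l) v = Q f v + Q g v"
    and Qscale: "\<And>s f v. Q (\<lambda>l. s * f l) v = s * Q f v"
    and ub: "\<And>f. P f \<Longrightarrow> (\<Sum>l<m. f l * c l) \<le> w"
    and least: "\<And>u. (\<And>f. P f \<Longrightarrow> (\<Sum>l<m. f l * c l) \<le> u) \<Longrightarrow> w \<le> u"
    and le: "\<And>v. Q y v \<le> t * q v"
  shows "(\<Sum>l<m. y l * c l) \<le> t * w"
proof -
  let ?c = "\<lambda>f. \<Sum>l<m. f l * c l"
  have cadd: "?c (\<lambda>l. f l + g l) = ?c f + ?c g" for f g
    by (simp add: algebra_simps sum.distrib)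
  have cscale: "?c (\<lambda>l. s * f l) = s * ?c f" for f s
    by (simp add: sum_distrib_left mult.assoc)
  have recession: "?c f \<le> 0" if "\<And>v. Q f v \<le> 0" for f
  proof (rule ccontr)
    assume "\<not> ?c f \<le> 0"
    then have pos: "?c f > 0" by simp
    \<comment> \<open>Scales the objective to \<open>\<bar>w\<bar> + 1\<close>, which exceeds
      \<open>w\<close>.\<close>
    let ?s = "(\<bar>w\<bar> + 1) / ?c f"
    have "?s \<ge> 0" using pos by simp
    then have "?s * Q f v \<le> q v" for v
      using mult_nonneg_nonpos[of ?s "Q f v"] that[of v] q[of v] by linarith
    then have "P (\<lambda>l. ?s * f l)" by (simp only: P_def Qscale) simp
    from ub[OF this] have "?s * ?c f \<le> w" by (simp only: cscale)
    then show False using pos by simp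
  qed
  consider "t > 0" | "t = 0" | "t < 0" by linarith
  then show ?thesis
  proof cases
    case 1
    have "1 / t * Q y v \<le> q v" for v using le[of v] 1 by (simp add: field_simps)
    then have "P (\<lambda>l. 1 / t * y l)" by (simp only: P_def Qscale) simp
    from ub[OF this] have "1 / t * ?c y \<le> w" by (simp only: cscale)
    then show ?thesis using 1 by (simp add: field_simps)
  next
    case 2
    then show ?thesis using recession[of y] le by simp
  next
    case 3
    let ?s = "1 / (- t)"
    have "?c f \<le> - (?s * ?c y)" if "P f" for f
    proof -
      have "Q (\<lambda>l. f l + ?s * y l) v \<le> 0" for v
      proof -
        have "?s * Q y v \<le> - q v" using le[of v] 3 by (simp add: field_simps)
        moreover have "Q f v \<le> q v" using that by (simp add: P_def)
        ultimately show ?thesis unfolding Qadd Qscale by linarith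
      qed
      from recession[OF this] show ?thesis unfolding cadd cscale by linarith
    qed
    from least[OF this] have "w \<le> - (?s * ?c y)" .
    then show ?thesis using 3 by (simp add: field_simps)
  qed
qed

text \<open>The problem is translated so that the feasible point with slack \<open>Z\<close> becomes
  the origin. Its constraint then reads \<open>Q f \<le> qform z\<close>, and its homogenisation
  involves only \<open>z\<close> and the \<open>A l\<close>.\<close>

lemma well_behaved_if_block_conditions:
  assumes A: "\<And>i. i < m \<Longrightarrow> sym_mat n (A i)" and B: "sym_mat n B" and rn: "r \<le> n"
    and Z: "Z \<in> carrier_mat n n" "\<And>i j. i < n \<Longrightarrow> j < n \<Longrightarrow> Z $$ (i, j) = (if i = j \<and> i < r then 1 else 0)"
    and slZ: "sdp_slack n m A B Z"
    and U: "pd_mat (n - r) U"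
    and AU: "\<And>l. l < m \<Longrightarrow> (\<Sum>i<n. \<Sum>j<n. A l $$ (i, j) * (if r \<le> i \<and> r \<le> j then U $$ (i - r, j - r) else 0)) = 0"
    and off: "\<And>x i j. (\<And>i j. r \<le> i \<Longrightarrow> i < n \<Longrightarrow> r \<le> j \<Longrightarrow> j < n \<Longrightarrow> (\<Sum>l<m. x l * A l $$ (i, j)) = 0) \<Longrightarrow>
      i < r \<Longrightarrow> r \<le> j \<Longrightarrow> j < n \<Longrightarrow> (\<Sum>l<m. x l * A l $$ (i, j)) = 0"
  shows "well_behaved n m A B"
  unfolding well_behaved_def badly_behaved_def
proof (rule notI, elim bexE conjE)
  fix c :: "real vec"
  assume c: "c \<in> carrier_vec m" and fin: "\<bar>sdp_primal_value n m A B c\<bar> \<noteq> \<infinity>"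
    and none: "\<not> (\<exists>Y\<in>sdp_dual_feasible n m A c. ereal (trace_prod B Y) = sdp_primal_value n m A B c)"
  have Bc: "B \<in> carrier_mat n n" using B by (simp add: sym_mat_def)
  have symA: "A l $$ (i, j) = A l $$ (j, i)" if "l < m" "i < n" "j < n" for l i j
    using A[OF that(1)] that by (simp add: sym_mat_iff)
  have symL: "sym_mat n (mat_lincomb n m A x)" for x using A by (rule sym_mat_lincomb)
  obtain w where w: "sdp_primal_value n m A B c = ereal w" using fin by auto
  obtain x0 where x0: "x0 \<in> carrier_vec m" "Z = B - mat_lincomb n m A x0"
    using slZ by (auto simp: sdp_slack_def)
  define z where "z = (\<lambda>i j. if i = j \<and> i < r then 1 else 0 :: real)"
  \<comment> \<open>The objective at that feasible point; the translated problem has optimal value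
    \<open>w - c0\<close>.\<close>
  define c0 where "c0 = (\<Sum>l<m. x0 $ l * c $ l)"
  define Q where "Q = (\<lambda>f v. qform {..<n} (\<lambda>i j. \<Sum>l<m. f l * A l $$ (i, j)) v)"
  have Qadd: "Q (\<lambda>l. f l + g l) v = Q f v + Q g v" for f g v
    unfolding Q_def qform_add[symmetric] by (simp add: algebra_simps sum.distrib)
  have Qscale: "Q (\<lambda>l. s * f l) v = s * Q f v" for s f v
    unfolding Q_def qform_scale[symmetric] by (simp add: sum_distrib_left mult.assoc)
  have slack_eq: "qform {..<n} (\<lambda>i j. (B - mat_lincomb n m A x) $$ (i, j)) v =
      qform {..<n} z v - Q (\<lambda>l. x $ l - x0 $ l) v" for x v
    unfolding Q_def qform_diff[symmetric]
  proof (rule qform_cong)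
    fix i j assume "i \<in> {..<n}" "j \<in> {..<n}"
    then have ij: "i < n" "j < n" by auto
    have "z i j = Z $$ (i, j)" using Z(2)[OF ij] by (simp add: z_def)
    also have "\<dots> = B $$ (i, j) - (\<Sum>l<m. x0 $ l * A l $$ (i, j))"
      unfolding x0(2) using ij by (simp add: mat_lincomb_def)
    finally show "(B - mat_lincomb n m A x) $$ (i, j) = z i j - (\<Sum>l<m. (x $ l - x0 $ l) * A l $$ (i, j))"
      using ij by (simp add: mat_lincomb_def left_diff_distrib sum_subtractf)
  qed simp
  have feas_iff: "x \<in> sdp_primal_feasible n m A B \<longleftrightarrow>
      x \<in> carrier_vec m \<and> (\<forall>v. Q (\<lambda>l. x $ l - x0 $ l) v \<le> qform {..<n} z v)" for x
  proof -
    have "sym_mat n (B - mat_lincomb n m A x)"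
      unfolding sym_mat_iff
    proof (intro conjI allI impI)
      show "B - mat_lincomb n m A x \<in> carrier_mat n n" by (rule minus_carrier_mat) simp
      show "(B - mat_lincomb n m A x) $$ (i, j) = (B - mat_lincomb n m A x) $$ (j, i)"
        if "i < n" "j < n" for i j
      proof -
        have "B $$ (i, j) = B $$ (j, i)" "mat_lincomb n m A x $$ (i, j) = mat_lincomb n m A x $$ (j, i)"
          using B symL[of x] that unfolding sym_mat_iff by blast+
        then show ?thesis using that by simp
      qed
    qed
    then show ?thesis
      by (simp add: sdp_primal_feasible_def loewner_le_def psd_mat_iff_qform slack_eq)
  qed
  have cx: "c \<bullet> x = (\<Sum>l<m. (x $ l - x0 $ l) * c $ l) + c0" if "x \<in> carrier_vec m" for x
    using that by (simp add: scalar_prod_def c0_def atLeast0LessThan sum_subtractf algebra_simps)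
  have shift: "(\<Sum>l<m. f l * c $ l) \<le> w - c0" if "\<forall>v. Q f v \<le> qform {..<n} z v" for f
  proof -
    let ?x = "vec m (\<lambda>l. f l + x0 $ l)"
    have eq: "Q (\<lambda>l. ?x $ l - x0 $ l) v = Q f v" for v
      unfolding Q_def by (rule qform_cong) simp_all
    have "?x \<in> sdp_primal_feasible n m A B" unfolding feas_iff eq using that by simp
    then have "ereal (c \<bullet> ?x) \<le> ereal w"
      unfolding w[symmetric] sdp_primal_value_def by (rule SUP_upper)
    then show ?thesis using cx[of ?x] by simp
  qed
  have least: "w - c0 \<le> u" if u: "\<And>f. \<forall>v. Q f v \<le> qform {..<n} z v \<Longrightarrow> (\<Sum>l<m. f l * c $ l) \<le> u" for u
  proof -
    have "ereal w \<le> ereal (u + c0)"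
      unfolding w[symmetric] sdp_primal_value_def
    proof (rule SUP_least)
      fix x assume x: "x \<in> sdp_primal_feasible n m A B"
      then show "ereal (c \<bullet> x) \<le> ereal (u + c0)"
        using u[of "\<lambda>l. x $ l - x0 $ l"] cx[of x] by (simp add: feas_iff)
    qed
    then show ?thesis by simp
  qed
  have qz: "0 \<le> qform {..<n} z v" for v
    unfolding z_def qform_partial_identity[OF rn] by (simp add: sum_nonneg)
  obtain Y where Ysym: "\<And>i j. i < n \<Longrightarrow> j < n \<Longrightarrow> Y i j = Y j i"
    and Yoff: "\<And>i j. i < r \<Longrightarrow> r \<le> j \<Longrightarrow> j < n \<Longrightarrow> Y i j = 0"
    and Ypsd: "\<And>v. 0 \<le> qform {..<r} Y v"
    and YA: "\<And>l. l < m \<Longrightarrow> (\<Sum>i<n. \<Sum>j<n. A l $$ (i, j) * Y i j) = c $ l"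
    and Yval: "(\<Sum>i<r. Y i i) = w - c0"
  proof (rule block_dual_functional[where m = m and A = "\<lambda>l i j. A l $$ (i, j)" and val = "w - c0" and c = "\<lambda>l. c $ l", OF rn])
    fix t x
    let ?G = "\<lambda>i j. t * (if i = j \<and> i < r then 1 else 0) + (\<Sum>l<m. x l * A l $$ (i, j))"
    assume pos: "\<And>v. 0 \<le> qform {..<r} ?G v" and zero: "\<And>v. qform {r..<n} ?G v = 0"
    have Gsym: "?G i j = ?G j i" if "i < n" "j < n" for i j
      using symA that by simp
    \<comment> \<open>A symmetric block with zero form is zero. Since \<open>z\<close> vanishes on
      it, \<open>off\<close> applies and removes the off-diagonal block, so that \<open>?G\<close>
      is positive semidefinite as a whole.\<close>
    have "?G i j = 0" if "r \<le> i" "i < n" "r \<le> j" "j < n" for i j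
      using that by (intro qform_eq_zero_imp[of "{r..<n}" ?G, OF _ Gsym zero]) auto
    then have "(\<Sum>l<m. x l * A l $$ (i, j)) = 0" if "r \<le> i" "i < n" "r \<le> j" "j < n" for i j
      using that by fastforce
    then have "(\<Sum>l<m. x l * A l $$ (i, j)) = 0" if "i < r" "r \<le> j" "j < n" for i j
      using that by (rule off)
    then have G12: "?G i j = 0" if "i < r" "r \<le> j" "j < n" for i j using that by simp
    have "qform {..<n} ?G v = qform {..<r} ?G v + qform {r..<n} ?G v" for v
    proof (rule qform_block_diag[OF rn])
      fix i j assume ij: "i < r" "r \<le> j" "j < n"
      show "?G i j = 0" by (rule G12[OF ij])
      then show "?G j i = 0" using Gsym[of i j] ij rn by simp
    qed
    then have nonneg: "0 \<le> qform {..<n} ?G v" for v using pos[of v] zero[of v] by simp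
    \<comment> \<open>Nonnegativity of \<open>?G\<close> bounds the form of \<open>- x\<close>;
      hence the sign change before the homogenised bound is used.\<close>
    have le: "Q (\<lambda>l. (- 1) * x l) v \<le> t * qform {..<n} z v" for v
    proof -
      have "qform {..<n} ?G v = t * qform {..<n} z v + Q x v"
        unfolding qform_add qform_scale Q_def z_def ..
      then show ?thesis using nonneg[of v] unfolding Qscale by simp
    qed
    have "(\<Sum>l<m. ((- 1) * x l) * c $ l) \<le> t * (w - c0)"
      by (rule homogenized_value_bound[where q = "qform {..<n} z" and Q = Q, OF qz Qadd Qscale shift least le])
    then show "0 \<le> t * (w - c0) + (\<Sum>l<m. x l * c $ l)" by (simp add: sum_negf)
  qed (rule that)
  define u where "u = (\<lambda>i j. if r \<le> i \<and> r \<le> j then U $$ (i - r, j - r) else 0)"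
  have qu: "qform {r..<n} u v = qform {..<n - r} (\<lambda>i j. U $$ (i, j)) (\<lambda>i. v (i + r))" for v
  proof -
    have "{r..<n} = (\<lambda>i. i + r) ` {..<n - r}"
      using rn by (simp add: lessThan_atLeast0)
    then show ?thesis by (simp add: qform_def u_def sum.reindex)
  qed
  have updef: "0 < qform {r..<n} u v" if v: "\<exists>i\<in>{r..<n}. v i \<noteq> 0" for v
  proof -
    obtain i where "r \<le> i" "i < n" "v i \<noteq> 0" using v by auto
    then have "\<exists>i<n - r. v (i + r) \<noteq> 0" by (intro exI[of _ "i - r"]) auto
    from U[unfolded pd_mat_iff_qform, THEN conjunct2, rule_format, OF this] show ?thesis
      unfolding qu .
  qed
  \<comment> \<open>The extension leaves the lower right block of \<open>Y\<close> uncontrolled.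
    Adding \<open>s * u\<close> repairs its sign and preserves the products with the
    \<open>A l\<close>, by \<open>AU\<close>, and with \<open>Z\<close>.\<close>
  obtain s where s: "\<And>v. 0 \<le> qform {r..<n} Y v + s * qform {r..<n} u v"
    using qform_add_large_multiple_nonneg[of "{r..<n}" u Y, OF _ updef] by blast
  define W where "W = mat n n (\<lambda>(i, j). Y i j + s * u i j)"
  have Wsym: "sym_mat n W"
    using Ysym U by (auto simp: sym_mat_iff W_def u_def pd_mat_def)
  have "0 \<le> qform {..<n} (\<lambda>i j. W $$ (i, j)) v" for v
  proof -
    have "qform {..<n} (\<lambda>i j. W $$ (i, j)) v = qform {..<n} (\<lambda>i j. Y i j + s * u i j) v"
      by (rule qform_cong) (auto simp: W_def)
    also have "\<dots> = qform {..<r} (\<lambda>i j. Y i j + s * u i j) v + qform {r..<n} (\<lambda>i j. Y i j + s * u i j) v"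
      using Yoff Ysym rn by (intro qform_block_diag) (auto simp: u_def)
    also have "qform {..<r} (\<lambda>i j. Y i j + s * u i j) v = qform {..<r} Y v"
      by (rule qform_cong) (auto simp: u_def)
    finally show ?thesis using Ypsd[of v] s[of v] by (simp add: qform_add qform_scale)
  qed
  then have Wpsd: "psd_mat n W" using Wsym by (simp add: psd_mat_iff_qform)
  have AW: "trace_prod (A l) W = c $ l" if "l < m" for l
  proof -
    have Al: "A l \<in> carrier_mat n n" using A[OF that] by (simp add: sym_mat_def)
    have "trace_prod (A l) W = (\<Sum>i<n. \<Sum>j<n. A l $$ (i, j) * Y i j + s * (A l $$ (i, j) * u i j))"
      unfolding trace_prod_sym_mat[OF Al Wsym] by (simp add: W_def algebra_simps)
    also have "\<dots> = (\<Sum>i<n. \<Sum>j<n. A l $$ (i, j) * Y i j) + s * (\<Sum>i<n. \<Sum>j<n. A l $$ (i, j) * u i j)"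
      by (simp add: sum.distrib sum_distrib_left)
    finally show ?thesis using YA[OF that] AU[OF that] by (simp add: u_def)
  qed
  have "trace_prod Z W = (\<Sum>i<n. \<Sum>j<n. if j = i then (if i < r then Y i i else 0) else 0)"
    unfolding trace_prod_sym_mat[OF Z(1) Wsym] by (intro sum.cong) (auto simp: Z(2) W_def u_def)
  also have "\<dots> = (\<Sum>i<n. if i < r then Y i i else 0)" by simp
  also have "\<dots> = (\<Sum>i<r. Y i i)"
    using rn by (intro sum.mono_neutral_cong_right) auto
  finally have ZW: "trace_prod Z W = w - c0" using Yval by simp
  \<comment> \<open>\<open>B\<close> is \<open>Z\<close> plus the combination of the
    \<open>A l\<close> with coefficients \<open>x0\<close>, which contributes
    \<open>c0\<close>.\<close>
  have "trace_prod Z W = trace_prod B W - c0"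
    unfolding x0(2) by (simp add: trace_prod_diff[OF Bc _ Wsym] trace_prod_lincomb[OF A Wsym] AW c0_def)
  then have "trace_prod B W = w" using ZW by simp
  moreover have "W \<in> sdp_dual_feasible n m A c" using Wpsd AW by (simp add: sdp_dual_feasible_def)
  ultimately show False using none w by auto
qed

section \<open>Equivalence of good behaviour and the block conditions\<close>

theorem theorem2:
  fixes n m r :: nat and A :: "nat \<Rightarrow> real mat" and B :: "real mat"
  assumes "\<And>i. i < m \<Longrightarrow> sym_mat n (A i)"
    and "sym_mat n B"
    and "sdp_primal_feasible n m A B \<noteq> {}"
    and "r \<le> n"
    and "max_rank_slack n m A B
           (four_block_mat (1\<^sub>m r) (0\<^sub>m r (n - r)) (0\<^sub>m (n - r) r) (0\<^sub>m (n - r) (n - r)))"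
  shows "well_behaved n m A B \<longleftrightarrow>
    (\<exists>U. pd_mat (n - r) U \<and>
       (\<forall>i<m. trace_prod (A i)
          (four_block_mat (0\<^sub>m r r) (0\<^sub>m r (n - r)) (0\<^sub>m (n - r) r) U) = 0)) \<and>
    (\<forall>x \<in> carrier_vec m. \<forall>V11 \<in> carrier_mat r r. \<forall>V12 \<in> carrier_mat r (n - r).
       mat_lincomb n m A x =
         four_block_mat V11 V12 (transpose_mat V12) (0\<^sub>m (n - r) (n - r)) \<longrightarrow>
       V12 = 0\<^sub>m r (n - r))"
proof -
  let ?Z = "four_block_mat (1\<^sub>m r) (0\<^sub>m r (n - r)) (0\<^sub>m (n - r) r) (0\<^sub>m (n - r) (n - r)) :: real mat"
  let ?E = "\<lambda>U :: real mat. four_block_mat (0\<^sub>m r r) (0\<^sub>m r (n - r)) (0\<^sub>m (n - r) r) U"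
  note A = assms(1) and B = assms(2) and feas = assms(3) and rn = assms(4) and max = assms(5)
  have symL: "sym_mat n (mat_lincomb n m A x)" for x using A by (rule sym_mat_lincomb)
  have Zc: "?Z \<in> carrier_mat n n" by (rule carrier_matI) (simp_all add: rn)
  note Zi = block_identity_index[OF rn]
  have E_index: "?E U $$ (i, j) = (if r \<le> i \<and> r \<le> j then U $$ (i - r, j - r) else 0)"
    if "U \<in> carrier_mat (n - r) (n - r)" "i < n" "j < n" for U i j
    using that by auto
  have E_sym: "sym_mat n (?E U)" if "sym_mat (n - r) U" for U
  proof -
    have U: "U \<in> carrier_mat (n - r) (n - r)" using that by (simp add: sym_mat_def)
    then have "?E U \<in> carrier_mat n n" by (intro carrier_matI) (simp_all add: rn)
    then show ?thesis using that by (auto simp: sym_mat_iff E_index[OF U] simp del: index_mat_four_block)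
  qed
  have E_trace: "trace_prod (A l) (?E U) =
      (\<Sum>i<n. \<Sum>j<n. A l $$ (i, j) * (if r \<le> i \<and> r \<le> j then U $$ (i - r, j - r) else 0))"
    if "sym_mat (n - r) U" "l < m" for U l
  proof -
    have U: "U \<in> carrier_mat (n - r) (n - r)" using that by (simp add: sym_mat_def)
    have "A l \<in> carrier_mat n n" using A[OF that(2)] by (simp add: sym_mat_def)
    from trace_prod_sym_mat[OF this E_sym[OF that(1)]] show ?thesis
      by (simp add: E_index[OF U] del: index_mat_four_block)
  qed
  show ?thesis
  proof
    assume well: "well_behaved n m A B"
    have dual: "\<exists>Y. psd_mat n Y \<and> (\<forall>i<n. \<forall>j<n. i < r \<or> j < r \<longrightarrow> Y $$ (i, j) = 0) \<and>
        (\<forall>i<m. trace_prod (A i) Y = trace_prod (A i) N)"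
      if N: "sym_mat n N" "\<And>i j. i < r \<Longrightarrow> j < r \<Longrightarrow> N $$ (i, j) = 0" for N
      by (rule well_behaved_dual_solution[where Z = ?Z and N = N and n = n and m = m and A = A and B = B and r = r])
        (fact A B feas rn Zc Zi max well N | blast)+
    show "(\<exists>U. pd_mat (n - r) U \<and> (\<forall>i<m. trace_prod (A i) (?E U) = 0)) \<and>
      (\<forall>x \<in> carrier_vec m. \<forall>V11 \<in> carrier_mat r r. \<forall>V12 \<in> carrier_mat r (n - r).
         mat_lincomb n m A x = four_block_mat V11 V12 (transpose_mat V12) (0\<^sub>m (n - r) (n - r)) \<longrightarrow>
         V12 = 0\<^sub>m r (n - r))"
    proof (intro conjI ballI impI)
      \<comment> \<open>Minus the identity on the lower right block, so that \<open>Y - N\<close>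
        has the positive definite lower right block \<open>U\<close> defined below, and no other
        nonzero block.\<close>
      define N where "N = mat n n (\<lambda>(i, j). if i = j \<and> r \<le> i then - 1 else 0 :: real)"
      have N: "sym_mat n N" "\<And>i j. i < r \<Longrightarrow> j < r \<Longrightarrow> N $$ (i, j) = 0"
        using rn by (auto simp: N_def sym_mat_iff)
      obtain Y where Y: "psd_mat n Y" "\<And>i j. i < n \<Longrightarrow> j < n \<Longrightarrow> i < r \<or> j < r \<Longrightarrow> Y $$ (i, j) = 0"
        and AY: "\<And>i. i < m \<Longrightarrow> trace_prod (A i) Y = trace_prod (A i) N"
        using dual[OF N] by blast
      have Ysym: "sym_mat n Y" using Y by (simp add: psd_mat_def)
      define U where "U = mat (n - r) (n - r) (\<lambda>(i, j). Y $$ (i + r, j + r) + (if i = j then 1 else 0))"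
      have Usym: "sym_mat (n - r) U"
        using Ysym by (auto simp: sym_mat_iff U_def)
      have "0 < qform {..<n - r} (\<lambda>i j. U $$ (i, j)) v" if v: "\<exists>i<n - r. v i \<noteq> 0" for v
      proof -
        have "qform {..<n - r} (\<lambda>i j. U $$ (i, j)) v =
            qform {..<n - r} (\<lambda>i j. Y $$ (i + r, j + r) + (if i = j then 1 else 0)) v"
          by (rule qform_cong) (auto simp: U_def)
        also have "\<dots> = qform {..<n - r} (\<lambda>i j. Y $$ (i + r, j + r)) v + (\<Sum>i<n - r. (v i)\<^sup>2)"
          by (simp add: qform_add qform_diag)
        also have "qform {..<n - r} (\<lambda>i j. Y $$ (i + r, j + r)) v =
            qform {r..<n} (\<lambda>i j. Y $$ (i, j)) (\<lambda>i. v (i - r))"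
        proof -
          have "{r..<n} = (\<lambda>i. i + r) ` {..<n - r}" using rn by (simp add: lessThan_atLeast0)
          then show ?thesis by (simp add: qform_def sum.reindex)
        qed
        also have "\<dots> = qform {..<n} (\<lambda>i j. Y $$ (i, j)) (\<lambda>i. v (i - r))"
          by (rule qform_restrict[symmetric]) (auto simp: Y(2) not_le)
        finally have "qform {..<n - r} (\<lambda>i j. U $$ (i, j)) v =
            qform {..<n} (\<lambda>i j. Y $$ (i, j)) (\<lambda>i. v (i - r)) + (\<Sum>i<n - r. (v i)\<^sup>2)" .
        moreover have "0 < (\<Sum>i<n - r. (v i)\<^sup>2)"
        proof -
          obtain i where "i < n - r" "v i \<noteq> 0" using v by blast
          then show ?thesis by (intro sum_pos2[of _ i]) auto
        qed
        ultimately show ?thesis using Y(1) by (simp add: psd_mat_iff_qform add_nonneg_pos)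
      qed
      then have "pd_mat (n - r) U" using Usym by (simp add: pd_mat_iff_qform)
      moreover have "trace_prod (A l) (?E U) = 0" if "l < m" for l
      proof -
        have Al: "A l \<in> carrier_mat n n" using A[OF that] by (simp add: sym_mat_def)
        have "trace_prod (A l) (?E U) = (\<Sum>i<n. \<Sum>j<n. A l $$ (i, j) * Y $$ (i, j) - A l $$ (i, j) * N $$ (i, j))"
          unfolding E_trace[OF Usym that]
          by (intro sum.cong) (auto simp: U_def N_def Y(2) algebra_simps eq_diff_iff)
        also have "\<dots> = trace_prod (A l) Y - trace_prod (A l) N"
          unfolding trace_prod_sym_mat[OF Al Ysym] trace_prod_sym_mat[OF Al N(1)] by (simp add: sum_subtractf)
        finally show ?thesis using AY[OF that] by simp
      qed
      ultimately show "\<exists>U. pd_mat (n - r) U \<and> (\<forall>i<m. trace_prod (A i) (?E U) = 0)" by blast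
    next
      fix x V11 V12
      assume V11: "V11 \<in> carrier_mat r r" and V12: "V12 \<in> carrier_mat r (n - r)"
        and V: "mat_lincomb n m A x = four_block_mat V11 V12 (transpose_mat V12) (0\<^sub>m (n - r) (n - r))"
      let ?V = "mat_lincomb n m A x"
      have V22: "?V $$ (i, j) = 0" if "r \<le> i" "i < n" "r \<le> j" "j < n" for i j
        unfolding V using that V11 V12 by auto
      have V12': "?V $$ (i, j + r) = V12 $$ (i, j)" if "i < r" "j < n - r" for i j
        unfolding V using that V11 V12 by auto
      have Vsym: "?V $$ (i, j) = ?V $$ (j, i)" if "i < n" "j < n" for i j
        using symL[of x] that by (simp add: sym_mat_iff)
      \<comment> \<open>\<open>V\<close> with its upper left block erased. Then
        \<open>V \<bullet> N\<close> is the sum of squares of the off-diagonal entries of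
        \<open>V\<close>, while \<open>V \<bullet> Y\<close> is zero because \<open>V\<close> and
        \<open>Y\<close> have no common nonzero block.\<close>
      define N where "N = mat n n (\<lambda>(i, j). if i < r \<and> j < r then 0 else ?V $$ (i, j))"
      have N: "sym_mat n N" "\<And>i j. i < r \<Longrightarrow> j < r \<Longrightarrow> N $$ (i, j) = 0"
        using rn Vsym by (auto simp: N_def sym_mat_iff)
      obtain Y where Y: "psd_mat n Y" "\<And>i j. i < n \<Longrightarrow> j < n \<Longrightarrow> i < r \<or> j < r \<Longrightarrow> Y $$ (i, j) = 0"
        and AY: "\<And>i. i < m \<Longrightarrow> trace_prod (A i) Y = trace_prod (A i) N"
        using dual[OF N] by blast
      have Ysym: "sym_mat n Y" using Y by (simp add: psd_mat_def)
      have "trace_prod ?V N = trace_prod ?V Y"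
        by (simp add: trace_prod_lincomb[OF A N(1)] trace_prod_lincomb[OF A Ysym] AY)
      also have "\<dots> = 0"
      proof -
        have "?V $$ (i, j) * Y $$ (i, j) = 0" if "i < n" "j < n" for i j
          using V22[of i j] Y(2)[of i j] that by (cases "i < r \<or> j < r") auto
        then show ?thesis unfolding trace_prod_sym_mat[OF mat_lincomb_carrier Ysym]
          by (intro sum.neutral ballI) simp
      qed
      finally have "(\<Sum>i<n. \<Sum>j<n. ?V $$ (i, j) * N $$ (i, j)) = 0"
        by (simp add: trace_prod_sym_mat[OF mat_lincomb_carrier N(1)])
      moreover have nonneg: "0 \<le> ?V $$ (i, j) * N $$ (i, j)" if "i < n" "j < n" for i j
        using that by (simp add: N_def)
      ultimately have row: "(\<Sum>j<n. ?V $$ (i, j) * N $$ (i, j)) = 0" if "i < n" for i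
        using that by (subst (asm) sum_nonneg_eq_0_iff) (auto intro!: sum_nonneg)
      have prod0: "?V $$ (i, j) * N $$ (i, j) = 0" if "i < n" "j < n" for i j
        using row[OF that(1)] that nonneg by (subst (asm) sum_nonneg_eq_0_iff) auto
      have "?V $$ (i, j + r) = 0" if "i < r" "j < n - r" for i j
        using prod0[of i "j + r"] that rn by (simp add: N_def)
      then show "V12 = 0\<^sub>m r (n - r)" using V12 V12' by (intro eq_matI) auto
    qed
  next
    assume cond: "(\<exists>U. pd_mat (n - r) U \<and> (\<forall>i<m. trace_prod (A i) (?E U) = 0)) \<and>
      (\<forall>x \<in> carrier_vec m. \<forall>V11 \<in> carrier_mat r r. \<forall>V12 \<in> carrier_mat r (n - r).
         mat_lincomb n m A x = four_block_mat V11 V12 (transpose_mat V12) (0\<^sub>m (n - r) (n - r)) \<longrightarrow>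
         V12 = 0\<^sub>m r (n - r))"
    then obtain U where U: "pd_mat (n - r) U" and AU: "\<And>i. i < m \<Longrightarrow> trace_prod (A i) (?E U) = 0" by blast
    have Usym: "sym_mat (n - r) U" using U by (simp add: pd_mat_def)
    have slZ: "sdp_slack n m A B ?Z" using max by (simp add: max_rank_slack_def)
    show "well_behaved n m A B"
    proof (rule well_behaved_if_block_conditions[OF A B rn Zc Zi slZ U])
      show "(\<Sum>i<n. \<Sum>j<n. A l $$ (i, j) * (if r \<le> i \<and> r \<le> j then U $$ (i - r, j - r) else 0)) = 0"
        if "l < m" for l
        using AU[OF that] unfolding E_trace[OF Usym that] .
    next
      fix x i j
      assume x: "\<And>i j. r \<le> i \<Longrightarrow> i < n \<Longrightarrow> r \<le> j \<Longrightarrow> j < n \<Longrightarrow> (\<Sum>l<m. x l * A l $$ (i, j)) = 0"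
        and ij: "i < r" "r \<le> j" "j < n"
      let ?V = "mat_lincomb n m A (vec m x)"
      define V11 where "V11 = mat r r (\<lambda>(i, j). ?V $$ (i, j))"
      define V12 where "V12 = mat r (n - r) (\<lambda>(i, j). ?V $$ (i, j + r))"
      have Vsym: "?V $$ (i, j) = ?V $$ (j, i)" if "i < n" "j < n" for i j
        using symL[of "vec m x"] that by (simp add: sym_mat_iff)
      have V22: "?V $$ (i, j) = 0" if "r \<le> i" "i < n" "r \<le> j" "j < n" for i j
        using x[OF that] that by (simp add: mat_lincomb_vec_index)
      have c: "V11 \<in> carrier_mat r r" "V12 \<in> carrier_mat r (n - r)" by (simp_all add: V11_def V12_def)
      \<comment> \<open>Symmetry of \<open>?V\<close> identifies its lower left block with the
        transpose of \<open>V12\<close>, which gives the shape that condition (2) asks for.\<close>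
      have "?V = four_block_mat V11 V12 (transpose_mat V12) (0\<^sub>m (n - r) (n - r))"
      proof (rule eq_matI)
        fix i j
        assume "i < dim_row (four_block_mat V11 V12 (transpose_mat V12) (0\<^sub>m (n - r) (n - r)))"
          "j < dim_col (four_block_mat V11 V12 (transpose_mat V12) (0\<^sub>m (n - r) (n - r)))"
        then have ij: "i < n" "j < n" using c rn by auto
        then show "?V $$ (i, j) = four_block_mat V11 V12 (transpose_mat V12) (0\<^sub>m (n - r) (n - r)) $$ (i, j)"
          using c rn V22[of i j] Vsym[of i j] by (auto simp: V11_def V12_def)
      qed (use c rn in \<open>auto simp: mat_lincomb_def\<close>)
      from cond[THEN conjunct2, rule_format, OF vec_carrier c this] have "V12 = 0\<^sub>m r (n - r)" .
      then have "V12 $$ (i, j - r) = 0" using ij by simp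
      then show "(\<Sum>l<m. x l * A l $$ (i, j)) = 0"
        using ij rn by (simp add: V12_def mat_lincomb_vec_index)
    qed
  qed
qed

end
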